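(* Consider Newtonian mechanics, that is, the case in which the metric tensor is the Euclidean one: let $U$ be a real analytic function and $\sigma$ a real analytic one-form on a neighbourhood of the origin $p=0$ in $\mathbb{R}^n$, with $U(0)=0$, $d_0U=0$, $U$ not a homogeneous polynomial, and let $U=U_{l_1}+U_{l_2}+\cdots$ display the first and second non-zero homogeneous terms of its Maclaurin series. Assume that the degree $d$ of the first non-zero jet of $\sigma$ at $p$ verifies $d-l_1/2>l_2-l_1$. If $U_{l_2}(q)<0$ for every critical point $q$ of $U_{l_1}|_{S^{n-1}}$ such that $U_{l_1}(q)\le 0$, then the point $p$ is totally unstable for the Lagrangian system $L(x,v)=\tfrac12\|v\|^2+\sigma_x(v)-U(x)$.
   Context: $l_1<l_2$ are the degrees of the first two non-zero homogeneous terms (so $l_1\ge 2$); $S^{n-1}$ is the Euclidean unit sphere. $d$ is the smallest degree of a non-zero homogeneous Taylor term of the coefficients of $\sigma$; if the germ of $\sigma$ is zero, the condition on $d$ is considered satisfied. The Euler–Lagrange flow is given by $\dot x=v$, $\dot v=-\nabla U(x)-\mathcal{R}(\iota_v d\sigma(x))$, where $\mathcal{R}$ is Euclidean Riesz duality from covectors to vectors. The energy $H(x,v)=\tfrac12\|v\|^2+U(x)$ is constant along orbits. $p$ is totally unstable if there is a neighbourhood $B$ of $p$ such that for every $z\in TB$ with $H(z)<0$, the positive orbit of $z$ is not contained in $TB$. *)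

theory Defs
  imports "HOL-Analysis.Analysis"
begin

section \<open>Power series in several variables\<close>

text \<open>Multi-indices are functions \<open>\<alpha> :: 'n \<Rightarrow> nat\<close>; \<open>mpow x \<alpha>\<close> is the monomial \<open>x\<^sup>\<alpha>\<close>.\<close>

definition mpow :: "real ^ 'n \<Rightarrow> ('n::finite \<Rightarrow> nat) \<Rightarrow> real" where
  "mpow x \<alpha> = (\<Prod>i\<in>UNIV. (x $ i) ^ \<alpha> i)"

definition has_power_series ::
    "(real ^ 'n \<Rightarrow> real) \<Rightarrow> real ^ 'n \<Rightarrow> (('n::finite \<Rightarrow> nat) \<Rightarrow> real) \<Rightarrow> bool" where
  "has_power_series f p c \<longleftrightarrow>
     (\<exists>r>0. \<forall>x\<in>ball p r. ((\<lambda>\<alpha>. c \<alpha> * mpow (x - p) \<alpha>) has_sum f x) UNIV)"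

definition real_analytic_on :: "(real ^ 'n::finite \<Rightarrow> real) \<Rightarrow> (real ^ 'n) set \<Rightarrow> bool" where
  "real_analytic_on f W \<longleftrightarrow> (\<forall>p\<in>W. \<exists>c. has_power_series f p c)"

text \<open>The coefficients of a convergent power series are determined by the germ of the function,
  so the choice is immaterial whenever \<open>f\<close> is real analytic near \<open>0\<close>.\<close>

definition maclaurin_coeff :: "(real ^ 'n::finite \<Rightarrow> real) \<Rightarrow> ('n \<Rightarrow> nat) \<Rightarrow> real" where
  "maclaurin_coeff f = (SOME c. has_power_series f 0 c)"

definition hom_form :: "(('n::finite \<Rightarrow> nat) \<Rightarrow> real) \<Rightarrow> nat \<Rightarrow> real ^ 'n \<Rightarrow> real" where
  "hom_form c k = (\<lambda>x. \<Sum>\<alpha> | (\<Sum>i\<in>UNIV. \<alpha> i) = k. c \<alpha> * mpow x \<alpha>)"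

definition homogeneous_polynomial :: "nat \<Rightarrow> (real ^ 'n::finite \<Rightarrow> real) \<Rightarrow> bool" where
  "homogeneous_polynomial k P \<longleftrightarrow> (\<exists>c. P = hom_form c k)"

definition hom_term :: "(real ^ 'n::finite \<Rightarrow> real) \<Rightarrow> nat \<Rightarrow> real ^ 'n \<Rightarrow> real" where
  "hom_term f k = hom_form (maclaurin_coeff f) k"

text \<open>\<open>l1 < l2\<close> are the degrees of the first two non-zero homogeneous terms of the
  Maclaurin series of \<open>f\<close>.\<close>

definition first_two_degrees :: "(real ^ 'n::finite \<Rightarrow> real) \<Rightarrow> nat \<Rightarrow> nat \<Rightarrow> bool" where
  "first_two_degrees f l1 l2 \<longleftrightarrow>
     l1 < l2 \<and> hom_term f l1 \<noteq> (\<lambda>x. 0) \<and> hom_term f l2 \<noteq> (\<lambda>x. 0) \<and>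
     (\<forall>k<l2. k \<noteq> l1 \<longrightarrow> hom_term f k = (\<lambda>x. 0))"


section \<open>Critical points on the sphere\<close>

text \<open>The tangent space of the unit sphere at \<open>q\<close> is the orthogonal complement of \<open>q\<close>, and the
  differential of a restriction is the restriction of the differential to the tangent space. In
  dimension one every point of the sphere is critical.\<close>

definition sphere_critical_point :: "(real ^ 'n::finite \<Rightarrow> real) \<Rightarrow> real ^ 'n \<Rightarrow> bool" where
  "sphere_critical_point f q \<longleftrightarrow>
     q \<in> sphere 0 1 \<and> (\<forall>w. q \<bullet> w = 0 \<longrightarrow> frechet_derivative f (at q) w = 0)"


section \<open>One-forms\<close>

type_synonym 'n one_form = "real ^ 'n \<Rightarrow> ((real ^ 'n) \<Rightarrow>\<^sub>L real)"

definition form_coeff :: "('n::finite) one_form \<Rightarrow> 'n \<Rightarrow> real ^ 'n \<Rightarrow> real" where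
  "form_coeff \<sigma> i x = blinfun_apply (\<sigma> x) (axis i 1)"

definition analytic_one_form_on :: "('n::finite) one_form \<Rightarrow> (real ^ 'n) set \<Rightarrow> bool" where
  "analytic_one_form_on \<sigma> W \<longleftrightarrow> (\<forall>i. real_analytic_on (form_coeff \<sigma> i) W)"

text \<open>Meaningful only if the germ of \<open>\<sigma>\<close> at \<open>0\<close> is non-zero.\<close>

definition first_jet_degree :: "('n::finite) one_form \<Rightarrow> nat" where
  "first_jet_degree \<sigma> = (LEAST k. \<exists>i. hom_term (form_coeff \<sigma> i) k \<noteq> (\<lambda>x. 0))"

definition exterior_deriv :: "('n::finite) one_form \<Rightarrow> real ^ 'n \<Rightarrow> real ^ 'n \<Rightarrow> real ^ 'n \<Rightarrow> real" where
  "exterior_deriv \<sigma> x v w =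
     blinfun_apply (frechet_derivative \<sigma> (at x) v) w
     - blinfun_apply (frechet_derivative \<sigma> (at x) w) v"

definition riesz :: "(real ^ 'n::finite \<Rightarrow> real) \<Rightarrow> real ^ 'n" where
  "riesz l = (THE r. \<forall>w. l w = r \<bullet> w)"

definition gradient :: "(real ^ 'n::finite \<Rightarrow> real) \<Rightarrow> real ^ 'n \<Rightarrow> real ^ 'n" where
  "gradient f x = (THE g. GDERIV f x :> g)"


section \<open>The Lagrangian system \<open>L(x,v) = \<parallel>v\<parallel>\<^sup>2/2 + \<sigma>\<^sub>x(v) - U(x)\<close>\<close>

definition energy :: "(real ^ 'n::finite \<Rightarrow> real) \<Rightarrow> (real ^ 'n) \<times> (real ^ 'n) \<Rightarrow> real" where
  "energy U z = (norm (snd z))\<^sup>2 / 2 + U (fst z)"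

text \<open>The Euler--Lagrange equations of \<open>L\<close> as a first-order system on \<open>TW = W \<times> UNIV\<close>.\<close>

definition EL_solution :: "(real ^ 'n) set \<Rightarrow> (real ^ 'n \<Rightarrow> real) \<Rightarrow> ('n::finite) one_form \<Rightarrow>
    real set \<Rightarrow> (real \<Rightarrow> real ^ 'n) \<Rightarrow> (real \<Rightarrow> real ^ 'n) \<Rightarrow> bool" where
  "EL_solution W U \<sigma> I x v \<longleftrightarrow>
     (\<forall>t\<in>I. x t \<in> W \<and>
        (x has_vector_derivative v t) (at t within I) \<and>
        (v has_vector_derivative
           (- gradient U (x t) - riesz (exterior_deriv \<sigma> (x t) (v t)))) (at t within I))"

text \<open>All states reached from \<open>z\<close> at times \<open>t \<ge> 0\<close> within the maximal interval of existence
  in \<open>TW\<close>; that interval may be bounded.\<close>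

definition positive_orbit :: "(real ^ 'n) set \<Rightarrow> (real ^ 'n \<Rightarrow> real) \<Rightarrow> ('n::finite) one_form \<Rightarrow>
    (real ^ 'n) \<times> (real ^ 'n) \<Rightarrow> ((real ^ 'n) \<times> (real ^ 'n)) set" where
  "positive_orbit W U \<sigma> z =
     {(x t, v t) | x v t. 0 \<le> t \<and> EL_solution W U \<sigma> {0..t} x v \<and> (x 0, v 0) = z}"

definition totally_unstable :: "(real ^ 'n) set \<Rightarrow> (real ^ 'n \<Rightarrow> real) \<Rightarrow> ('n::finite) one_form \<Rightarrow>
    real ^ 'n \<Rightarrow> bool" where
  "totally_unstable W U \<sigma> p \<longleftrightarrow>
     (\<exists>B. open B \<and> p \<in> B \<and> B \<subseteq> W \<and>
        (\<forall>z \<in> B \<times> UNIV. energy U z < 0 \<longrightarrow> \<not> positive_orbit W U \<sigma> z \<subseteq> B \<times> UNIV))"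

end

(* The radial field almost works: by Euler's identity the derivative of x . v along the flow is
   |v|^2 - l1 U - (l2 - l1) U_{l2} - dsigma(v, x) + O(|x|^(l2+1)), which has the right sign wherever
   U_{l2} < 0. Since U_{l2} is only controlled near the critical points of U_{l1} on the sphere, the
   field is corrected by a multiple of the tangential gradient of U_{l1}, scaled to be homogeneous of
   degree l2 - l1 + 1. The correction contributes a term of order |x|^l2, positive away from the
   critical points, while its derivative tends to 0 at the origin, so that it costs only a small
   multiple of |v|^2. The magnetic term is absorbed by |v|^2/4 + O(|x|^(2d)) with 2d > l2. Hence
   the derivative of Y(x) . v is at least -l1 U, which is at least l1 |h| at energy h < 0. As Y(x) . v
   is bounded while the orbit stays near the origin, the orbit has to leave. *)

theory Submission
  imports Defs
begin

section \<open>Homogeneous forms\<close>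

text \<open>The sign condition on U_{l2} concerns critical points with U_{l1} <= 0, whereas negative
  energy only gives U < 0, where U_{l1} on the sphere may still be positive, of order |x|^(l2-l1).
  Compactness must therefore yield an estimate valid for U_{l1} <= \<epsilon>, and the radius is
  chosen after \<epsilon>. The correction contains a possibly negative power of |x| and is used only
  off the origin; since U(0) = 0, the origin lies outside U < 0.

  The positive orbit consists of states reached by solutions, so its confinement says nothing until
  a solution is known to exist for long enough. Existence on a prescribed interval [0, T] is drawn
  from the confinement itself: it bounds x, conservation of energy bounds v, and a field cut off
  outside a compact set has a global solution. The field has to be Lipschitz there, which is why the
  power series are differentiated twice. The length T is fixed beforehand by the bound on Y(x) . v
  and the growth rate l1 |h|.\<close>

lemma finite_multi_index: "finite {\<alpha> :: 'n::finite \<Rightarrow> nat. (\<Sum>i\<in>UNIV. \<alpha> i) = k}"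
proof (rule finite_subset)
  show "{\<alpha> :: 'n \<Rightarrow> nat. (\<Sum>i\<in>UNIV. \<alpha> i) = k} \<subseteq> PiE UNIV (\<lambda>_. {..k})"
    by (auto intro!: member_le_sum)
  show "finite (PiE (UNIV :: 'n set) (\<lambda>_. {..k}))"
    by (rule finite_PiE) auto
qed

lemma abs_mpow_le: "\<bar>mpow x \<alpha>\<bar> \<le> norm x ^ (\<Sum>i\<in>UNIV. \<alpha> i)"
proof -
  have "\<bar>mpow x \<alpha>\<bar> = (\<Prod>i\<in>UNIV. \<bar>x $ i\<bar> ^ \<alpha> i)"
    by (simp add: mpow_def abs_prod power_abs)
  also have "\<dots> \<le> (\<Prod>i\<in>UNIV. norm x ^ \<alpha> i)"
    by (intro prod_mono conjI power_mono component_le_norm_cart) auto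
  finally show ?thesis by (simp add: power_sum)
qed

lemma mpow_scaleR: "mpow (t *\<^sub>R x) \<alpha> = t ^ (\<Sum>i\<in>UNIV. \<alpha> i) * mpow x \<alpha>"
  by (simp add: mpow_def power_mult_distrib prod.distrib power_sum)

text \<open>The l1-norm of the coefficients of degree k. It reduces convergence in several variables
  to that of one real power series in the radius.\<close>

definition coeff_mass :: "(('n::finite \<Rightarrow> nat) \<Rightarrow> real) \<Rightarrow> nat \<Rightarrow> real" where
  "coeff_mass c k = (\<Sum>\<alpha> | (\<Sum>i\<in>UNIV. \<alpha> i) = k. \<bar>c \<alpha>\<bar>)"

lemma coeff_mass_nonneg: "0 \<le> coeff_mass c k"
  by (simp add: coeff_mass_def sum_nonneg)

lemma abs_hom_form_le:
  fixes x :: "real ^ 'n::finite"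
  shows "\<bar>hom_form c k x\<bar> \<le> coeff_mass c k * norm x ^ k"
proof -
  have "\<bar>hom_form c k x\<bar> \<le> (\<Sum>\<alpha> | (\<Sum>i\<in>UNIV. \<alpha> i) = k. \<bar>c \<alpha> * mpow x \<alpha>\<bar>)"
    unfolding hom_form_def by (rule sum_abs)
  also have "\<dots> \<le> (\<Sum>\<alpha> | (\<Sum>i\<in>UNIV. \<alpha> i) = k. \<bar>c \<alpha>\<bar> * norm x ^ k)"
  proof (rule sum_mono)
    fix \<alpha> :: "'n \<Rightarrow> nat" assume "\<alpha> \<in> {\<alpha>. (\<Sum>i\<in>UNIV. \<alpha> i) = k}"
    then show "\<bar>c \<alpha> * mpow x \<alpha>\<bar> \<le> \<bar>c \<alpha>\<bar> * norm x ^ k"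
      using abs_mpow_le[of x \<alpha>] by (simp add: abs_mult mult_left_mono)
  qed
  finally show ?thesis by (simp add: coeff_mass_def sum_distrib_right)
qed

lemma hom_form_scaleR: "hom_form c k (t *\<^sub>R x) = t ^ k * hom_form c k x"
  by (simp add: hom_form_def mpow_scaleR sum_distrib_left mult_ac)

lemma hom_form_0: "hom_form c 0 x = c (\<lambda>_. 0)"
proof -
  have "{\<alpha> :: 'a \<Rightarrow> nat. (\<Sum>i\<in>UNIV. \<alpha> i) = 0} = {\<lambda>_. 0}"
    by auto
  then show ?thesis by (simp add: hom_form_def mpow_def)
qed

section \<open>Formal partial derivatives, gradients of forms and Euler's identity\<close>

definition partial_coeff :: "'n \<Rightarrow> (('n::finite \<Rightarrow> nat) \<Rightarrow> real) \<Rightarrow> ('n \<Rightarrow> nat) \<Rightarrow> real" where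
  "partial_coeff i c = (\<lambda>\<alpha>. real (\<alpha> i + 1) * c (\<alpha>(i := \<alpha> i + 1)))"

text \<open>The index is the degree of the components: this is the gradient of the form of degree
  \<open>k + 1\<close>. The shift runs through all later gradient expansions.\<close>

definition form_gradient :: "(('n::finite \<Rightarrow> nat) \<Rightarrow> real) \<Rightarrow> nat \<Rightarrow> real ^ 'n \<Rightarrow> real ^ 'n" where
  "form_gradient c k x = (\<chi> i. hom_form (partial_coeff i c) k x)"

lemma has_derivative_mpow:
  fixes x :: "real ^ 'n::finite"
  shows "((\<lambda>x. mpow x \<alpha>) has_derivative
    (\<lambda>h. \<Sum>i\<in>UNIV. h $ i * (real (\<alpha> i) * mpow x (\<alpha>(i := \<alpha> i - 1))))) (at x)"
proof -
  have d: "((\<lambda>x. (x $ i) ^ \<alpha> i) has_derivative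
      (\<lambda>h. h $ i * (real (\<alpha> i) * (x $ i) ^ (\<alpha> i - 1)))) (at x)" for i
    by (auto intro!: derivative_eq_intros bounded_linear_imp_has_derivative bounded_linear_vec_nth simp: mult_ac)
  have e: "mpow x (\<alpha>(i := \<alpha> i - 1)) = (x $ i) ^ (\<alpha> i - 1) * (\<Prod>j\<in>UNIV - {i}. (x $ j) ^ \<alpha> j)" for i
    unfolding mpow_def by (subst prod.remove[of _ i]) auto
  have "((\<lambda>x. \<Prod>i\<in>UNIV. (x $ i) ^ \<alpha> i) has_derivative
      (\<lambda>h. \<Sum>i\<in>UNIV. (h $ i * (real (\<alpha> i) * (x $ i) ^ (\<alpha> i - 1))) *
         (\<Prod>j\<in>UNIV - {i}. (x $ j) ^ \<alpha> j))) (at x)"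
    by (rule has_derivative_prod) (rule d)
  then show ?thesis unfolding mpow_def[of _ \<alpha>] e by (simp add: mult_ac)
qed

lemma sum_degree_fun_upd:
  fixes \<alpha> :: "'n::finite \<Rightarrow> nat"
  shows "(\<Sum>j\<in>UNIV. (\<alpha>(i := m)) j) + \<alpha> i = (\<Sum>j\<in>UNIV. \<alpha> j) + m"
proof -
  have "(\<Sum>j\<in>UNIV. (\<alpha>(i := m)) j) = m + (\<Sum>j\<in>UNIV - {i}. \<alpha> j)"
    by (subst sum.remove[of _ i]) auto
  moreover have "(\<Sum>j\<in>UNIV. \<alpha> j) = \<alpha> i + (\<Sum>j\<in>UNIV - {i}. \<alpha> j)"
    by (subst sum.remove[of _ i]) auto
  ultimately show ?thesis by simp
qed

text \<open>Lowering the i-th exponent is a bijection on the multi-indices with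
  \<open>\<alpha> i > 0\<close>; the others carry the factor 0, so the truncated subtraction is
  harmless. The weight \<open>F\<close> is left free: monomials give the derivative of a form, the
  constant 1 the coefficient mass of that derivative.\<close>

lemma sum_partial_coeff:
  fixes c :: "('n::finite \<Rightarrow> nat) \<Rightarrow> real" and F :: "('n \<Rightarrow> nat) \<Rightarrow> real"
  shows "(\<Sum>\<alpha> | (\<Sum>j\<in>UNIV. \<alpha> j) = Suc k. real (\<alpha> i) * c \<alpha> * F (\<alpha>(i := \<alpha> i - 1))) =
    (\<Sum>\<beta> | (\<Sum>j\<in>UNIV. \<beta> j) = k. partial_coeff i c \<beta> * F \<beta>)"
proof (rule sym, rule sum.reindex_bij_witness_not_neutral[where S' = "{}" and
      T' = "{\<alpha>. (\<Sum>j\<in>UNIV. \<alpha> j) = Suc k \<and> \<alpha> i = 0}" and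
      j = "\<lambda>\<beta>. \<beta>(i := \<beta> i + 1)" and i = "\<lambda>\<alpha>. \<alpha>(i := \<alpha> i - 1)"])
  show "finite {\<alpha>. (\<Sum>j\<in>UNIV. \<alpha> j) = Suc k \<and> \<alpha> i = 0}"
    by (rule finite_subset[OF _ finite_multi_index[of "Suc k"]]) auto
next
  fix \<beta> :: "'n \<Rightarrow> nat" assume "\<beta> \<in> {\<beta>. (\<Sum>j\<in>UNIV. \<beta> j) = k} - {}"
  then show "\<beta>(i := \<beta> i + 1) \<in> {\<alpha>. (\<Sum>j\<in>UNIV. \<alpha> j) = Suc k} -
      {\<alpha>. (\<Sum>j\<in>UNIV. \<alpha> j) = Suc k \<and> \<alpha> i = 0}"
    using sum_degree_fun_upd[of \<beta> i "\<beta> i + 1"] by simp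
next
  fix \<alpha> :: "'n \<Rightarrow> nat" assume "\<alpha> \<in> {\<alpha>. (\<Sum>j\<in>UNIV. \<alpha> j) = Suc k} -
      {\<alpha>. (\<Sum>j\<in>UNIV. \<alpha> j) = Suc k \<and> \<alpha> i = 0}"
  then show "\<alpha>(i := \<alpha> i - 1) \<in> {\<beta>. (\<Sum>j\<in>UNIV. \<beta> j) = k} - {}"
    using sum_degree_fun_upd[of \<alpha> i "\<alpha> i - 1"] by (auto simp del: fun_upd_apply)
qed (auto simp: partial_coeff_def)

lemma hom_form_has_derivative:
  "(hom_form c (Suc k) has_derivative (\<lambda>h. form_gradient c k x \<bullet> h)) (at x)"
proof -
  let ?S = "{\<alpha> :: 'a \<Rightarrow> nat. (\<Sum>i\<in>UNIV. \<alpha> i) = Suc k}"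
  have "((\<lambda>x. \<Sum>\<alpha>\<in>?S. c \<alpha> * mpow x \<alpha>) has_derivative
      (\<lambda>h. \<Sum>\<alpha>\<in>?S. c \<alpha> * (\<Sum>i\<in>UNIV. h $ i * (real (\<alpha> i) * mpow x (\<alpha>(i := \<alpha> i - 1)))))) (at x)"
    by (intro has_derivative_sum has_derivative_mult_right has_derivative_mpow)
  moreover have "(\<Sum>\<alpha>\<in>?S. c \<alpha> * (\<Sum>i\<in>UNIV. h $ i * (real (\<alpha> i) * mpow x (\<alpha>(i := \<alpha> i - 1)))))
      = form_gradient c k x \<bullet> h" for h
  proof -
    have "(\<Sum>\<alpha>\<in>?S. c \<alpha> * (\<Sum>i\<in>UNIV. h $ i * (real (\<alpha> i) * mpow x (\<alpha>(i := \<alpha> i - 1)))))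
        = (\<Sum>i\<in>UNIV. \<Sum>\<alpha>\<in>?S. h $ i * (real (\<alpha> i) * c \<alpha> * mpow x (\<alpha>(i := \<alpha> i - 1))))"
      by (simp add: sum_distrib_left mult_ac) (rule sum.swap)
    also have "\<dots> = (\<Sum>i\<in>UNIV. h $ i * hom_form (partial_coeff i c) k x)"
      unfolding hom_form_def sum_distrib_left[symmetric] sum_partial_coeff ..
    also have "\<dots> = form_gradient c k x \<bullet> h"
      by (simp add: form_gradient_def inner_vec_def mult.commute)
    finally show ?thesis .
  qed
  ultimately show ?thesis by (simp add: hom_form_def[abs_def])
qed

lemma coeff_mass_partial_coeff: "coeff_mass (partial_coeff i c) k \<le> real (Suc k) * coeff_mass c (Suc k)"
proof -
  have "coeff_mass (partial_coeff i c) k =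
      (\<Sum>\<beta> | (\<Sum>j\<in>UNIV. \<beta> j) = k. partial_coeff i (\<lambda>\<alpha>. \<bar>c \<alpha>\<bar>) \<beta> * 1)"
    by (simp add: coeff_mass_def partial_coeff_def abs_mult)
  also have "\<dots> = (\<Sum>\<alpha> | (\<Sum>j\<in>UNIV. \<alpha> j) = Suc k. real (\<alpha> i) * \<bar>c \<alpha>\<bar> * 1)"
    by (rule sum_partial_coeff[symmetric])
  also have "\<dots> \<le> (\<Sum>\<alpha> | (\<Sum>j\<in>UNIV. \<alpha> j) = Suc k. real (Suc k) * \<bar>c \<alpha>\<bar>)"
  proof (rule sum_mono)
    fix \<alpha> :: "'a \<Rightarrow> nat" assume "\<alpha> \<in> {\<alpha>. (\<Sum>j\<in>UNIV. \<alpha> j) = Suc k}"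
    then have "\<alpha> i \<le> Suc k" using member_le_sum[of i UNIV \<alpha>] by simp
    then show "real (\<alpha> i) * \<bar>c \<alpha>\<bar> * 1 \<le> real (Suc k) * \<bar>c \<alpha>\<bar>"
      by (simp add: mult_right_mono del: of_nat_Suc)
  qed
  finally show ?thesis by (simp add: coeff_mass_def sum_distrib_left)
qed

lemma form_gradient_scaleR: "form_gradient c k (t *\<^sub>R x) = t ^ k *\<^sub>R form_gradient c k x"
  by (simp add: form_gradient_def hom_form_scaleR vec_eq_iff)

text \<open>Uniqueness of the derivative avoids showing that a form vanishing as a function has
  vanishing coefficients.\<close>

lemma form_gradient_eq_0:
  assumes "hom_form c (Suc k) = (\<lambda>x. 0)"
  shows "form_gradient c k x = 0"
proof -
  have "((\<lambda>x. 0 :: real) has_derivative (\<lambda>h. form_gradient c k x \<bullet> h)) (at x)"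
    using hom_form_has_derivative[of c k x] assms by simp
  moreover have "((\<lambda>x. 0 :: real) has_derivative (\<lambda>h. 0)) (at x)" by simp
  ultimately have "(\<lambda>h. form_gradient c k x \<bullet> h) = (\<lambda>h. 0)"
    by (rule has_derivative_unique)
  then show ?thesis by (metis inner_eq_zero_iff)
qed

text \<open>Euler's identity: the restriction of the form to the ray through x is differentiated at
  t = 1 by the chain rule and by homogeneity.\<close>

lemma form_gradient_inner_self: "form_gradient c k x \<bullet> x = real (Suc k) * hom_form c (Suc k) x"
proof -
  have "((\<lambda>t. hom_form c (Suc k) (t *\<^sub>R x)) has_derivative
      (\<lambda>s. form_gradient c k (1 *\<^sub>R x) \<bullet> (s *\<^sub>R x))) (at 1)"
    by (rule has_derivative_compose[where g = "hom_form c (Suc k)" and f = "\<lambda>t. t *\<^sub>R x"])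
      (auto intro!: derivative_eq_intros hom_form_has_derivative[THEN has_derivative_eq_rhs])
  then have "((\<lambda>t. hom_form c (Suc k) (t *\<^sub>R x)) has_real_derivative form_gradient c k x \<bullet> x) (at 1)"
    unfolding has_field_derivative_def by (rule has_derivative_eq_rhs) (auto simp: mult.commute)
  moreover have "((\<lambda>t. t ^ Suc k * hom_form c (Suc k) x) has_real_derivative
      real (Suc k) * hom_form c (Suc k) x) (at 1)"
    by (auto intro!: derivative_eq_intros)
  ultimately show ?thesis
    unfolding hom_form_scaleR by (rule DERIV_unique)
qed

lemma norm_vec_le: "(\<And>i. \<bar>x $ i\<bar> \<le> b i) \<Longrightarrow> norm (x :: real ^ 'n::finite) \<le> (\<Sum>i\<in>UNIV. b i)"
  by (rule order_trans[OF norm_le_l1_cart]) (rule sum_mono, simp)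

lemma norm_form_gradient_le:
  "norm (form_gradient c k x) \<le> (\<Sum>i\<in>UNIV. coeff_mass (partial_coeff i c) k) * norm x ^ k"
  unfolding sum_distrib_right
  by (rule norm_vec_le) (simp add: form_gradient_def abs_hom_form_le)

lemma has_derivative_vecI:
  fixes f :: "'a::real_normed_vector \<Rightarrow> real ^ 'n::finite"
  assumes "\<And>i. ((\<lambda>x. f x $ i) has_derivative (\<lambda>h. f' h $ i)) (at a within S)"
  shows "(f has_derivative f') (at a within S)"
proof (subst has_derivative_componentwise_within, rule ballI)
  fix b :: "real ^ 'n" assume "b \<in> Basis"
  then obtain i where "b = axis i 1" by (auto simp: Basis_vec_def)
  then show "((\<lambda>x. f x \<bullet> b) has_derivative (\<lambda>x. f' x \<bullet> b)) (at a within S)"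
    using assms[of i] by (simp add: inner_axis)
qed

lemma form_gradient_has_derivative:
  "(form_gradient c (Suc k) has_derivative
     (\<lambda>h. \<chi> i. form_gradient (partial_coeff i c) k x \<bullet> h)) (at x)"
proof -
  have "form_gradient c (Suc k) = (\<lambda>x. \<chi> i. hom_form (partial_coeff i c) (Suc k) x)"
    by (rule ext) (simp only: form_gradient_def)
  then show ?thesis
    by (auto intro!: has_derivative_vecI hom_form_has_derivative)
qed

lemma continuous_on_hom_form: "continuous_on S (hom_form c k)"
  unfolding hom_form_def mpow_def by (intro continuous_intros)

lemma continuous_on_form_gradient: "continuous_on S (form_gradient c k)"
  unfolding form_gradient_def[abs_def]
  by (intro continuous_on_vec_lambda continuous_on_hom_form)

section \<open>Termwise differentiation\<close>

text \<open>Sums over multi-indices are regrouped into ordinary series of forms. Requiring the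
  majorant to be summable at the radius itself makes the convergence uniform on the whole open
  ball.\<close>

definition hom_expansion :: "(real ^ 'n \<Rightarrow> real) \<Rightarrow> (('n::finite \<Rightarrow> nat) \<Rightarrow> real) \<Rightarrow> real \<Rightarrow> bool" where
  "hom_expansion f c \<rho> \<longleftrightarrow> 0 < \<rho> \<and> summable (\<lambda>k. coeff_mass c k * \<rho> ^ k) \<and>
     (\<forall>x\<in>ball 0 \<rho>. f x = (\<Sum>k. hom_form c k x))"

text \<open>At the point whose coordinates all equal \<rho>, every monomial of degree k has the
  value \<rho>^k. Since \<open>has_sum\<close> over the reals is absolute convergence, evaluating
  there makes the coefficient masses a summable majorant.\<close>

lemma has_power_series_imp_hom_expansion:
  fixes f :: "real ^ 'n::finite \<Rightarrow> real"
  assumes "has_power_series f 0 c"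
  shows "\<exists>\<rho>. hom_expansion f c \<rho>"
proof -
  let ?deg = "\<lambda>\<alpha> :: 'n \<Rightarrow> nat. \<Sum>i\<in>UNIV. \<alpha> i"
  let ?D = "\<lambda>k. {\<alpha> :: 'n \<Rightarrow> nat. ?deg \<alpha> = k}"
  from assms obtain r where r: "r > 0"
    and hs: "\<And>x. x \<in> ball 0 r \<Longrightarrow> ((\<lambda>\<alpha>. c \<alpha> * mpow x \<alpha>) has_sum f x) UNIV"
    unfolding has_power_series_def by auto
  have bij: "bij_betw (\<lambda>\<alpha>. (?deg \<alpha>, \<alpha>)) UNIV (Sigma UNIV ?D)"
    by (rule bij_betwI[where g = snd]) auto
  have group: "(\<lambda>k. \<Sum>\<alpha>\<in>?D k. F \<alpha>) sums s" if "(F has_sum s) UNIV" for F :: "('n \<Rightarrow> nat) \<Rightarrow> real" and s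
  proof -
    have "((\<lambda>p. F (snd p)) has_sum s) (Sigma UNIV ?D)"
      using that has_sum_reindex_bij_betw[OF bij, of "\<lambda>p. F (snd p)" s] by simp
    then have "((\<lambda>k. \<Sum>\<alpha>\<in>?D k. F \<alpha>) has_sum s) UNIV"
      by (rule has_sum_SigmaD) (auto intro!: has_sum_finiteI finite_multi_index)
    then show ?thesis by (rule has_sum_imp_sums)
  qed
  \<comment> \<open>The diagonal point has norm at most n \<rho>, with n the dimension; the divisor
    2n puts it inside the ball of radius r.\<close>
  define \<rho> where "\<rho> = r / (2 * real CARD('n))"
  have \<rho>: "0 < \<rho>" using r by (simp add: \<rho>_def)
  define y :: "real ^ 'n" where "y = (\<chi> i. \<rho>)"
  have "norm y \<le> (\<Sum>i\<in>(UNIV :: 'n set). \<rho>)"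
    by (rule norm_vec_le) (use \<rho> in \<open>simp add: y_def\<close>)
  also have "\<dots> < r" using r by (simp add: \<rho>_def)
  finally have "y \<in> ball 0 r" by simp
  then have "(\<lambda>\<alpha>. c \<alpha> * mpow y \<alpha>) summable_on UNIV"
    using hs by (auto simp: summable_on_def)
  then have "(\<lambda>\<alpha>. \<bar>c \<alpha> * mpow y \<alpha>\<bar>) summable_on UNIV"
    unfolding real_norm_def[symmetric] by (rule summable_on_iff_abs_summable_on_real[THEN iffD1])
  moreover have "\<bar>c \<alpha> * mpow y \<alpha>\<bar> = \<bar>c \<alpha>\<bar> * \<rho> ^ ?deg \<alpha>" for \<alpha>
    using \<rho> by (simp add: mpow_def y_def abs_mult power_sum abs_prod)
  ultimately have "(\<lambda>k. \<Sum>\<alpha>\<in>?D k. \<bar>c \<alpha>\<bar> * \<rho> ^ ?deg \<alpha>) sums infsum (\<lambda>\<alpha>. \<bar>c \<alpha>\<bar> * \<rho> ^ ?deg \<alpha>) UNIV"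
    by (intro group has_sum_infsum) simp
  moreover have "(\<Sum>\<alpha>\<in>?D k. \<bar>c \<alpha>\<bar> * \<rho> ^ ?deg \<alpha>) = coeff_mass c k * \<rho> ^ k" for k
    by (simp add: coeff_mass_def sum_distrib_right)
  ultimately have "summable (\<lambda>k. coeff_mass c k * \<rho> ^ k)"
    by (auto simp: sums_iff)
  moreover have "f x = (\<Sum>k. hom_form c k x)" if "x \<in> ball 0 \<rho>" for x
  proof -
    have "\<rho> \<le> r"
    proof -
      have "1 \<le> real CARD('n)" using one_le_card_finite[where 'a = 'n] by simp
      then have "r / (2 * real CARD('n)) \<le> r / 1"
        using r by (intro divide_left_mono) linarith+
      then show ?thesis by (simp add: \<rho>_def)
    qed
    then have "x \<in> ball 0 r" using that by simp
    from group[OF hs[OF this]] show ?thesis by (simp add: sums_iff hom_form_def)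
  qed
  ultimately show ?thesis using \<rho> unfolding hom_expansion_def by blast
qed

section \<open>Uniform convergence and Taylor remainders\<close>

lemma hom_form_norm_le:
  assumes "norm x \<le> \<rho>"
  shows "norm (hom_form c k x) \<le> coeff_mass c k * \<rho> ^ k"
proof -
  have "\<bar>hom_form c k x\<bar> \<le> coeff_mass c k * norm x ^ k" by (rule abs_hom_form_le)
  also have "\<dots> \<le> coeff_mass c k * \<rho> ^ k"
    by (intro mult_left_mono power_mono assms coeff_mass_nonneg norm_ge_zero)
  finally show ?thesis by simp
qed

lemma hom_expansion_uniform_limit:
  assumes "hom_expansion f c \<rho>"
  shows "uniform_limit (ball 0 \<rho>) (\<lambda>n x. \<Sum>k<n. hom_form c k x) f sequentially"
proof -
  have "uniform_limit (ball 0 \<rho>) (\<lambda>n x. \<Sum>k<n. hom_form c k x) (\<lambda>x. \<Sum>k. hom_form c k x) sequentially"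
    using assms by (intro Weierstrass_m_test[where M = "\<lambda>k. coeff_mass c k * \<rho> ^ k"] hom_form_norm_le)
      (auto simp: hom_expansion_def)
  then show ?thesis
    by (rule uniform_limit_cong'[THEN iffD1, rotated -1]) (use assms in \<open>auto simp: hom_expansion_def\<close>)
qed

lemma hom_expansion_sums:
  assumes "hom_expansion f c \<rho>" "x \<in> ball 0 \<rho>"
  shows "(\<lambda>k. hom_form c k x) sums f x"
  using tendsto_uniform_limitI[OF hom_expansion_uniform_limit[OF assms(1)] assms(2)]
  by (simp add: sums_def)

text \<open>The tail is dominated by \<open>norm x ^ m\<close> times the series \<open>M\<close>,
  which is the shifted majorant divided by \<rho>^m. The case m = 0 serves later as a plain
  bound.\<close>

lemma hom_expansion_remainder:
  assumes "hom_expansion f c \<rho>"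
  shows "\<exists>C\<ge>0. \<forall>x\<in>ball 0 \<rho>. \<bar>f x - (\<Sum>k<m. hom_form c k x)\<bar> \<le> C * norm x ^ m"
proof -
  define M where "M k = coeff_mass c (k + m) * \<rho> ^ k" for k
  have \<rho>: "\<rho> > 0" using assms by (simp add: hom_expansion_def)
  have "summable (\<lambda>k. coeff_mass c (k + m) * \<rho> ^ (k + m))"
    using assms by (subst summable_iff_shift[of "\<lambda>k. coeff_mass c k * \<rho> ^ k"]) (simp add: hom_expansion_def)
  then have "summable (\<lambda>k. (1 / \<rho> ^ m) * (coeff_mass c (k + m) * \<rho> ^ (k + m)))"
    by (rule summable_mult)
  then have M: "summable M" using \<rho> by (simp add: M_def[abs_def] power_add)
  have "\<bar>f x - (\<Sum>k<m. hom_form c k x)\<bar> \<le> suminf M * norm x ^ m" if x: "x \<in> ball 0 \<rho>" for x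
  proof -
    have s: "(\<lambda>k. hom_form c (k + m) x) sums (f x - (\<Sum>k<m. hom_form c k x))"
      using sums_split_initial_segment[OF hom_expansion_sums[OF assms x], of m] by simp
    have b: "norm (hom_form c (k + m) x) \<le> M k * norm x ^ m" for k
    proof -
      have "\<bar>hom_form c (k + m) x\<bar> \<le> coeff_mass c (k + m) * (norm x ^ k * norm x ^ m)"
        using abs_hom_form_le[of c "k + m" x] by (simp add: power_add)
      also have "\<dots> \<le> coeff_mass c (k + m) * (\<rho> ^ k * norm x ^ m)"
        using x by (intro mult_left_mono mult_right_mono power_mono coeff_mass_nonneg) auto
      finally show ?thesis by (simp add: M_def)
    qed
    have "norm (\<Sum>k. hom_form c (k + m) x) \<le> (\<Sum>k. M k * norm x ^ m)"
      by (rule norm_suminf_le[OF b summable_mult2[OF M]])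
    then show ?thesis using s M by (simp add: sums_iff suminf_mult2[symmetric])
  qed
  moreover have "suminf M \<ge> 0"
    using M \<rho> by (intro suminf_nonneg) (auto simp: M_def coeff_mass_nonneg)
  ultimately show ?thesis by blast
qed


section \<open>Term-by-term differentiation on smaller balls\<close>

lemma power_times_linear_bounded:
  fixes q :: real
  assumes "0 < q" "q < 1"
  shows "\<exists>K. \<forall>k. real (Suc k) * q ^ k \<le> K"
proof -
  have "(\<lambda>k. real k * q ^ k) \<longlonglongrightarrow> 0"
    using assms by (intro powser_times_n_limit_0) auto
  moreover have "(\<lambda>k. q ^ k) \<longlonglongrightarrow> 0"
    using assms by (intro LIMSEQ_power_zero) auto
  ultimately have "(\<lambda>k. real k * q ^ k + q ^ k) \<longlonglongrightarrow> 0 + 0"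
    by (rule tendsto_add)
  then have "Bseq (\<lambda>k. real k * q ^ k + q ^ k)"
    by (intro convergent_imp_Bseq) (auto simp: convergent_def)
  then obtain K where K: "norm (real k * q ^ k + q ^ k) \<le> K" for k
    unfolding Bseq_def by blast
  have "real (Suc k) * q ^ k \<le> K" for k
    using K[of k] by (simp add: distrib_right)
  then show ?thesis by blast
qed

text \<open>Differentiation costs a factor k + 1 in the majorant; the smaller radius pays for it,
  because (k + 1) q^k is bounded for q = \<rho>'/\<rho> < 1.\<close>

lemma hom_expansion_partial:
  assumes f: "hom_expansion f c \<rho>" and \<rho>': "0 < \<rho>'" "\<rho>' < \<rho>"
  shows "hom_expansion (\<lambda>x. \<Sum>k. hom_form (partial_coeff i c) k x) (partial_coeff i c) \<rho>'"
proof -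
  have \<rho>: "0 < \<rho>" using \<rho>' by linarith
  obtain K where K: "\<And>k. real (Suc k) * (\<rho>' / \<rho>) ^ k \<le> K"
    using power_times_linear_bounded[of "\<rho>' / \<rho>"] \<rho>' by auto
  have "summable (\<lambda>k. coeff_mass c k * \<rho> ^ k)"
    using f by (simp add: hom_expansion_def)
  then have "summable (\<lambda>k. coeff_mass c (Suc k) * \<rho> ^ Suc k)"
    by (subst summable_Suc_iff)
  then have s: "summable (\<lambda>k. (K / \<rho>) * (coeff_mass c (Suc k) * \<rho> ^ Suc k))"
    by (rule summable_mult)
  have "summable (\<lambda>k. coeff_mass (partial_coeff i c) k * \<rho>' ^ k)"
  proof (rule summable_comparison_test[OF _ s], intro exI allI impI)
    fix k
    have "coeff_mass (partial_coeff i c) k * \<rho>' ^ k \<le> real (Suc k) * coeff_mass c (Suc k) * \<rho>' ^ k"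
      using \<rho>' by (intro mult_right_mono coeff_mass_partial_coeff) auto
    also have "\<dots> = (real (Suc k) * (\<rho>' / \<rho>) ^ k) * (coeff_mass c (Suc k) * \<rho> ^ k)"
      using \<rho> by (simp add: power_divide)
    also have "\<dots> \<le> K * (coeff_mass c (Suc k) * \<rho> ^ k)"
      using \<rho> by (intro mult_right_mono K mult_nonneg_nonneg coeff_mass_nonneg) auto
    finally show "norm (coeff_mass (partial_coeff i c) k * \<rho>' ^ k) \<le> (K / \<rho>) * (coeff_mass c (Suc k) * \<rho> ^ Suc k)"
      using \<rho> \<rho>' by (simp add: abs_mult coeff_mass_nonneg)
  qed
  then show ?thesis using \<rho>' by (simp add: hom_expansion_def)
qed

lemma hom_expansion_has_derivative:
  fixes f :: "real ^ 'n::finite \<Rightarrow> real"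
  assumes f: "hom_expansion f c \<rho>" and x: "x \<in> ball 0 \<rho>'" and \<rho>': "\<rho>' < \<rho>"
    and g: "\<And>i. hom_expansion (\<lambda>x. g x $ i) (partial_coeff i c) \<rho>'"
  shows "(f has_derivative (\<lambda>h. g x \<bullet> h)) (at x)"
proof -
  let ?B = "ball (0 :: real ^ 'n) \<rho>'"
  \<comment> \<open>The constant term is split off, since the gradients start with that of the
    linear form; it is added back to \<open>F\<close> at the end.\<close>
  have sums_f: "(\<lambda>k. hom_form c (Suc k) y) sums (f y - hom_form c 0 y)" if "y \<in> ?B" for y
  proof -
    have "(\<lambda>k. hom_form c k y) sums f y"
      using hom_expansion_sums[OF f, of y] that \<rho>' by simp
    then show ?thesis
      by (subst sums_Suc_iff[of "\<lambda>k. hom_form c k y"]) simp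
  qed
  have "\<exists>F. \<forall>y\<in>?B. (\<lambda>k. hom_form c (Suc k) y) sums F y \<and>
      (F has_derivative (\<lambda>h. g y \<bullet> h)) (at y within ?B)"
  proof (rule has_derivative_series[where f' = "\<lambda>k y h. form_gradient c k y \<bullet> h"])
    fix e :: real assume e: "e > 0"
    \<comment> \<open>The norm is bounded by the sum of the coordinates, so each coordinate gets an
      equal share of the error.\<close>
    define e' where "e' = e / real CARD('n)"
    have e': "e' > 0" using e by (simp add: e'_def)
    have "\<forall>\<^sub>F n in sequentially. \<forall>y\<in>?B. dist (\<Sum>k<n. hom_form (partial_coeff i c) k y) (g y $ i) < e'" for i
      using uniform_limitD[OF hom_expansion_uniform_limit[OF g] e'] .
    then have "\<forall>\<^sub>F n in sequentially. \<forall>i. \<forall>y\<in>?B. dist (\<Sum>k<n. hom_form (partial_coeff i c) k y) (g y $ i) < e'"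
      by (intro eventually_all_finite)
    then show "\<forall>\<^sub>F n in sequentially. \<forall>y\<in>?B. \<forall>h.
        norm ((\<Sum>k<n. form_gradient c k y \<bullet> h) - g y \<bullet> h) \<le> e * norm h"
    proof (rule eventually_mono, intro ballI allI)
      fix n and y h :: "real ^ 'n" assume n: "\<forall>i. \<forall>y\<in>?B. dist (\<Sum>k<n. hom_form (partial_coeff i c) k y) (g y $ i) < e'"
        and y: "y \<in> ?B"
      have "norm ((\<Sum>k<n. form_gradient c k y) - g y) \<le> (\<Sum>i\<in>(UNIV :: 'n set). e')"
        by (rule norm_vec_le) (use n y in \<open>auto simp: form_gradient_def dist_real_def less_imp_le\<close>)
      also have "\<dots> = e" by (simp add: e'_def)
      finally have "norm ((\<Sum>k<n. form_gradient c k y) - g y) * norm h \<le> e * norm h"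
        by (rule mult_right_mono) simp
      moreover have "norm ((\<Sum>k<n. form_gradient c k y \<bullet> h) - g y \<bullet> h) \<le>
          norm ((\<Sum>k<n. form_gradient c k y) - g y) * norm h"
        using Cauchy_Schwarz_ineq2[of "(\<Sum>k<n. form_gradient c k y) - g y" h]
        by (simp add: inner_diff_left inner_sum_left)
      ultimately show "norm ((\<Sum>k<n. form_gradient c k y \<bullet> h) - g y \<bullet> h) \<le> e * norm h" by linarith
    qed
  next
    show "(\<lambda>k. hom_form c (Suc k) x) sums (f x - hom_form c 0 x)" by (rule sums_f[OF x])
  qed (use x in \<open>auto intro: has_derivative_at_withinI hom_form_has_derivative\<close>)
  then obtain F where F: "\<And>y. y \<in> ?B \<Longrightarrow> (\<lambda>k. hom_form c (Suc k) y) sums F y"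
      "(F has_derivative (\<lambda>h. g x \<bullet> h)) (at x within ?B)"
    using x by blast
  have "(F has_derivative (\<lambda>h. g x \<bullet> h)) (at x)"
    using F(2) x by (simp add: at_within_open[OF x])
  then have "((\<lambda>y. F y + c (\<lambda>_. 0)) has_derivative (\<lambda>h. g x \<bullet> h)) (at x)"
    using has_derivative_add[OF _ has_derivative_const] by fastforce
  moreover have "F y + c (\<lambda>_. 0) = f y" if "y \<in> ?B" for y
    using sums_unique2[OF F(1)[OF that] sums_f[OF that]] by (simp add: hom_form_0)
  ultimately show ?thesis
    using has_derivative_transform_within_open[OF _ open_ball x] by blast
qed

lemma hom_expansion_gradient:
  fixes f :: "real ^ 'n::finite \<Rightarrow> real"
  assumes f: "hom_expansion f c \<rho>" and \<rho>': "0 < \<rho>'" "\<rho>' < \<rho>"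
  shows "\<exists>g. (\<forall>i. hom_expansion (\<lambda>x. g x $ i) (partial_coeff i c) \<rho>') \<and>
    (\<forall>x\<in>ball 0 \<rho>'. (f has_derivative (\<lambda>h. g x \<bullet> h)) (at x))"
proof -
  define g :: "real ^ 'n \<Rightarrow> real ^ 'n" where
    "g x = (\<chi> i. \<Sum>k. hom_form (partial_coeff i c) k x)" for x
  have g: "hom_expansion (\<lambda>x. g x $ i) (partial_coeff i c) \<rho>'" for i
    unfolding g_def using hom_expansion_partial[OF f \<rho>'] by simp
  with hom_expansion_has_derivative[OF f _ \<rho>'(2) g] show ?thesis by blast
qed

text \<open>The Lipschitz constant, needed for the existence of solutions, comes from bounded second
  derivatives on a convex ball. Each of the two differentiations shrinks the ball, to \<rho>/2 and
  then to \<rho>/4.\<close>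

lemma analytic_gradient:
  fixes f :: "real ^ 'n::finite \<Rightarrow> real"
  assumes "has_power_series f 0 c"
  shows "\<exists>\<rho>>0. \<exists>g L. (\<forall>x\<in>ball 0 \<rho>. (f has_derivative (\<lambda>h. g x \<bullet> h)) (at x)) \<and>
    L-lipschitz_on (ball 0 \<rho>) g \<and>
    (\<forall>m. \<exists>C\<ge>0. \<forall>x\<in>ball 0 \<rho>. \<bar>f x - (\<Sum>k<m. hom_form c k x)\<bar> \<le> C * norm x ^ m) \<and>
    (\<forall>m. \<exists>C\<ge>0. \<forall>x\<in>ball 0 \<rho>. norm (g x - (\<Sum>k<m. form_gradient c k x)) \<le> C * norm x ^ m)"
proof -
  obtain \<rho> where f: "hom_expansion f c \<rho>"
    using has_power_series_imp_hom_expansion[OF assms] by blast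
  then have \<rho>: "\<rho> > 0" by (simp add: hom_expansion_def)
  then have half: "0 < \<rho> / 2" "\<rho> / 2 < \<rho>" by auto
  obtain g where g: "\<And>i. hom_expansion (\<lambda>x. g x $ i) (partial_coeff i c) (\<rho> / 2)"
    and dg: "\<And>x. x \<in> ball 0 (\<rho> / 2) \<Longrightarrow> (f has_derivative (\<lambda>h. g x \<bullet> h)) (at x)"
    using hom_expansion_gradient[OF f half] by blast
  have "\<exists>h. (\<forall>j. hom_expansion (\<lambda>x. h x $ j) (partial_coeff j (partial_coeff i c)) (\<rho> / 4)) \<and>
    (\<forall>x\<in>ball 0 (\<rho> / 4). ((\<lambda>x. g x $ i) has_derivative (\<lambda>v. h x \<bullet> v)) (at x))" for i
    using hom_expansion_gradient[OF g, of "\<rho> / 4"] \<rho> by auto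
  then obtain H where H: "\<And>i j. hom_expansion (\<lambda>x. H i x $ j) (partial_coeff j (partial_coeff i c)) (\<rho> / 4)"
    and dH: "\<And>i x. x \<in> ball 0 (\<rho> / 4) \<Longrightarrow> ((\<lambda>x. g x $ i) has_derivative (\<lambda>v. H i x \<bullet> v)) (at x)"
    by metis
  \<comment> \<open>The remainder estimate of order 0 is boundedness.\<close>
  have "\<exists>C. \<forall>x\<in>ball 0 (\<rho> / 4). \<bar>H i x $ j\<bar> \<le> C" for i j
    using hom_expansion_remainder[OF H[of i j], of 0] by auto
  then obtain C where C: "\<And>i j x. x \<in> ball 0 (\<rho> / 4) \<Longrightarrow> \<bar>H i x $ j\<bar> \<le> C i j"
    by metis
  define L where "L = (\<Sum>i\<in>UNIV. \<Sum>j\<in>UNIV. C i j)"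
  have C0: "C i j \<ge> 0" for i j using C[of 0 i j] \<rho> by (smt (verit) centre_in_ball divide_pos_pos)
  have "norm ((\<chi> i. H i x \<bullet> v) :: real ^ 'n) \<le> L * norm v" if x: "x \<in> ball 0 (\<rho> / 4)" for x v
    unfolding L_def
  proof (subst sum_distrib_right, rule norm_vec_le)
    fix i
    have "norm (H i x) \<le> (\<Sum>j\<in>UNIV. C i j)" by (rule norm_vec_le) (rule C[OF x])
    then have "norm (H i x) * norm v \<le> (\<Sum>j\<in>UNIV. C i j) * norm v" by (rule mult_right_mono) simp
    then show "\<bar>((\<chi> i. H i x \<bullet> v) :: real ^ 'n) $ i\<bar> \<le> (\<Sum>j\<in>UNIV. C i j) * norm v"
      using Cauchy_Schwarz_ineq2[of "H i x" v] by simp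
  qed
  then have on: "onorm (\<lambda>v. (\<chi> i. H i x \<bullet> v) :: real ^ 'n) \<le> L" if "x \<in> ball 0 (\<rho> / 4)" for x
    using that by (auto intro!: onorm_le simp del: mem_ball mem_ball_0)
  have "L-lipschitz_on (ball 0 (\<rho> / 4)) g"
  proof (rule lipschitz_onI)
    fix x y :: "real ^ 'n" assume xy: "x \<in> ball 0 (\<rho> / 4)" "y \<in> ball 0 (\<rho> / 4)"
    have "norm (g x - g y) \<le> L * norm (x - y)"
    proof (rule differentiable_bound[OF convex_ball _ on xy])
      fix z :: "real ^ 'n" assume "z \<in> ball 0 (\<rho> / 4)"
      then have "(g has_derivative (\<lambda>v. \<chi> i. H i z \<bullet> v)) (at z)"
        by (intro has_derivative_vecI) (simp add: dH)
      then show "(g has_derivative (\<lambda>v. \<chi> i. H i z \<bullet> v)) (at z within ball 0 (\<rho> / 4))"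
        by (rule has_derivative_at_withinI)
    qed
    then show "dist (g x) (g y) \<le> L * dist x y" by (simp add: dist_norm)
  qed (use C0 in \<open>auto simp: L_def intro!: sum_nonneg\<close>)
  moreover have "\<exists>K\<ge>0. \<forall>x\<in>ball 0 (\<rho> / 4). \<bar>f x - (\<Sum>k<m. hom_form c k x)\<bar> \<le> K * norm x ^ m" for m
    using hom_expansion_remainder[OF f, of m] \<rho> by auto
  moreover have "\<exists>K\<ge>0. \<forall>x\<in>ball 0 (\<rho> / 4). norm (g x - (\<Sum>k<m. form_gradient c k x)) \<le> K * norm x ^ m" for m
  proof -
    have "\<forall>i. \<exists>K\<ge>0. \<forall>x\<in>ball 0 (\<rho> / 2). \<bar>g x $ i - (\<Sum>k<m. hom_form (partial_coeff i c) k x)\<bar> \<le> K * norm x ^ m"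
      using hom_expansion_remainder[OF g] by blast
    then obtain K where K: "\<And>i. K i \<ge> 0"
      "\<And>i x. x \<in> ball 0 (\<rho> / 2) \<Longrightarrow> \<bar>g x $ i - (\<Sum>k<m. hom_form (partial_coeff i c) k x)\<bar> \<le> K i * norm x ^ m"
      by metis
    have "norm (g x - (\<Sum>k<m. form_gradient c k x)) \<le> (\<Sum>i\<in>UNIV. K i) * norm x ^ m"
      if "x \<in> ball 0 (\<rho> / 4)" for x
      unfolding sum_distrib_right
      by (rule norm_vec_le) (use K(2)[of x] that \<rho> in \<open>simp add: form_gradient_def\<close>)
    moreover have "(\<Sum>i\<in>UNIV. K i) \<ge> 0" using K(1) by (intro sum_nonneg) auto
    ultimately show ?thesis by blast
  qed
  ultimately show ?thesis
    using dg \<rho> by (intro exI[of _ "\<rho> / 4"] exI[of _ g] exI[of _ L] conjI) auto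
qed

section \<open>Autonomous differential equations\<close>

text \<open>The weight \<open>exp (- \<Lambda> t)\<close> makes the Picard operator a contraction on the whole interval
  \<open>[0, T]\<close>, whatever its length.\<close>

lemma lipschitz_ode_solution:
  fixes F :: "'a::banach \<Rightarrow> 'a"
  assumes F: "L-lipschitz_on UNIV F" and T: "0 \<le> T"
  shows "\<exists>z. z 0 = z0 \<and> (\<forall>t\<in>{0..T}. (z has_vector_derivative F (z t)) (at t within {0..T}))"
proof -
  \<comment> \<open>The contraction factor will be L / \<Lambda> \<le> 1/2; the summand 1 keeps
    \<Lambda> positive when L = 0.\<close>
  define \<Lambda> where "\<Lambda> = 2 * L + 1"
  have L: "0 \<le> L" using F by (rule lipschitz_on_nonneg)
  have \<Lambda>: "\<Lambda> > 0" using L by (simp add: \<Lambda>_def)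
  have contF: "continuous_on UNIV F" using F by (rule lipschitz_on_continuous_on)
  \<comment> \<open>The unknown w is the solution multiplied by exp (- \<Lambda> t), so the supremum
    metric on w is the weighted metric on solutions.\<close>
  define G where "G w s = F (exp (\<Lambda> * s) *\<^sub>R apply_bcontfun w s)" for w :: "real \<Rightarrow>\<^sub>C 'a" and s
  have contG: "continuous_on S (G w)" for w S
    unfolding G_def by (intro continuous_on_compose2[OF contF] continuous_intros) auto
  have intG: "G w integrable_on {0..t}" for w t
    by (intro integrable_continuous_real contG)
  define \<Phi> where "\<Phi> w t = exp (- \<Lambda> * t) *\<^sub>R (z0 + integral {0..t} (G w))" for w t
  have "continuous_on (cbox 0 T) (\<Phi> w)" for w
    unfolding \<Phi>_def cbox_interval
    by (intro continuous_intros indefinite_integral_continuous_1 intG)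
  \<comment> \<open>Bounded continuous functions live on the whole line; clamping extends the values
    on [0, T] by constants.\<close>
  then have "\<exists>g :: real \<Rightarrow>\<^sub>C 'a. \<forall>t. g t = \<Phi> w (clamp 0 T t)" for w
    by (meson continuous_on_cbox_bcontfunE)
  then obtain P :: "(real \<Rightarrow>\<^sub>C 'a) \<Rightarrow> (real \<Rightarrow>\<^sub>C 'a)" where P: "\<And>w t. P w t = \<Phi> w (clamp 0 T t)"
    by metis
  have contr: "dist (P w1) (P w2) \<le> 1/2 * dist w1 w2" for w1 w2
  proof (rule dist_bound)
    fix t
    define s where "s = clamp 0 T t"
    have s: "0 \<le> s" using clamp_in_interval[of 0 T t] T by (simp add: s_def)
    define D where "D = dist w1 w2"
    have D: "norm (G w1 r - G w2 r) \<le> L * D * exp (\<Lambda> * r)" for r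
    proof -
      have "norm (G w1 r - G w2 r) \<le> L * dist (exp (\<Lambda> * r) *\<^sub>R w1 r) (exp (\<Lambda> * r) *\<^sub>R w2 r)"
        unfolding G_def dist_norm[symmetric] by (rule lipschitz_onD[OF F]) auto
      also have "\<dots> = L * (exp (\<Lambda> * r) * dist (w1 r) (w2 r))"
        by (simp add: dist_norm flip: scaleR_diff_right)
      also have "\<dots> \<le> L * (exp (\<Lambda> * r) * D)"
        unfolding D_def by (intro mult_left_mono dist_bounded L) auto
      finally show ?thesis by (simp add: mult_ac)
    qed
    have hi: "((\<lambda>r. L * D * exp (\<Lambda> * r)) has_integral
        (L * D / \<Lambda> * exp (\<Lambda> * s) - L * D / \<Lambda> * exp (\<Lambda> * 0))) {0..s}"
      using \<Lambda> by (intro fundamental_theorem_of_calculus s)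
        (auto intro!: derivative_eq_intros simp flip: has_real_derivative_iff_has_vector_derivative)
    have "norm (integral {0..s} (\<lambda>r. G w1 r - G w2 r)) \<le> L * D / \<Lambda> * exp (\<Lambda> * s) - L * D / \<Lambda> * exp (\<Lambda> * 0)"
      unfolding integral_unique[OF hi, symmetric]
      by (intro integral_norm_bound_integral integrable_diff intG has_integral_integrable[OF hi] D)
    also have "\<dots> \<le> 1/2 * D * exp (\<Lambda> * s)"
    proof -
      have "L * D / \<Lambda> \<le> 1/2 * D" "0 \<le> L * D / \<Lambda>"
        using L \<Lambda> by (auto simp: D_def \<Lambda>_def field_simps)
      then have "L * D / \<Lambda> * exp (\<Lambda> * s) \<le> 1/2 * D * exp (\<Lambda> * s)" by (intro mult_right_mono) auto
      then show ?thesis using \<open>0 \<le> L * D / \<Lambda>\<close> by simp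
    qed
    finally have *: "norm (integral {0..s} (G w1) - integral {0..s} (G w2)) \<le> 1/2 * D * exp (\<Lambda> * s)"
      by (simp add: integral_diff intG)
    have "dist (P w1 t) (P w2 t) = exp (- \<Lambda> * s) * norm (integral {0..s} (G w1) - integral {0..s} (G w2))"
      by (simp add: P s_def[symmetric] \<Phi>_def dist_norm flip: scaleR_diff_right)
    also have "\<dots> \<le> exp (- \<Lambda> * s) * (1/2 * D * exp (\<Lambda> * s))"
      by (intro mult_left_mono *) auto
    also have "\<dots> = 1/2 * D" by (simp add: exp_minus)
    finally show "dist (P w1 t) (P w2 t) \<le> 1/2 * dist w1 w2" by (simp add: D_def)
  qed
  obtain w where w: "P w = w"
    using banach_fix_type[of "1/2" P] contr by auto
  define z where "z t = z0 + integral {0..t} (G w)" for t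
  have zw: "exp (\<Lambda> * t) *\<^sub>R w t = z t" if "t \<in> {0..T}" for t
  proof -
    have "w t = \<Phi> w (clamp 0 T t)" using P[of w t] w by simp
    also have "clamp 0 T t = t" using that by (intro clamp_cancel_cbox) simp
    finally show ?thesis by (simp add: \<Phi>_def z_def exp_minus)
  qed
  have "(z has_vector_derivative F (z t)) (at t within {0..T})" if t: "t \<in> {0..T}" for t
  proof -
    have "((\<lambda>u. integral {0..u} (G w)) has_vector_derivative G w t) (at t within {0..T})"
      by (rule integral_has_vector_derivative[OF contG t])
    then have "(z has_vector_derivative 0 + G w t) (at t within {0..T})"
      unfolding z_def by (intro derivative_intros)
    then show ?thesis using zw[OF t] by (simp add: G_def)
  qed
  then show ?thesis by (intro exI[of _ z]) (simp add: z_def)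
qed

text \<open>Composing the field with the projection onto \<open>K\<close> makes it globally Lipschitz; a solution of
  the modified equation cannot leave \<open>K\<close>, since up to its first exit from the interior it solves
  the original one.\<close>

lemma ode_solution_in_compact:
  fixes F :: "'a::euclidean_space \<Rightarrow> 'a"
  assumes K: "convex K" "closed K" and F: "L-lipschitz_on K F"
    and z0: "z0 \<in> interior K" and T: "0 \<le> T"
    and confined: "\<And>t z. \<lbrakk>0 \<le> t; z 0 = z0; \<And>s. s \<in> {0..t} \<Longrightarrow> z s \<in> K;
        \<And>s. s \<in> {0..t} \<Longrightarrow> (z has_vector_derivative F (z s)) (at s within {0..t})\<rbrakk>
        \<Longrightarrow> z t \<in> interior K"
  shows "\<exists>z. z 0 = z0 \<and> (\<forall>t\<in>{0..T}. z t \<in> K \<and> (z has_vector_derivative F (z t)) (at t within {0..T}))"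
proof -
  let ?\<pi> = "closest_point K"
  have ne: "K \<noteq> {}" using z0 interior_subset by blast
  have "L-lipschitz_on UNIV (\<lambda>x. F (?\<pi> x))"
  proof (rule lipschitz_onI)
    fix x y
    have "dist (F (?\<pi> x)) (F (?\<pi> y)) \<le> L * dist (?\<pi> x) (?\<pi> y)"
      by (intro lipschitz_onD[OF F] closest_point_in_set K ne)
    also have "\<dots> \<le> L * dist x y"
      by (intro mult_left_mono closest_point_lipschitz K ne lipschitz_on_nonneg[OF F])
    finally show "dist (F (?\<pi> x)) (F (?\<pi> y)) \<le> L * dist x y" .
  qed (rule lipschitz_on_nonneg[OF F])
  from lipschitz_ode_solution[OF this T] obtain z where z: "z 0 = z0"
    and dz: "\<And>t. t \<in> {0..T} \<Longrightarrow> (z has_vector_derivative F (?\<pi> (z t))) (at t within {0..T})"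
    by blast
  have contz: "continuous_on {0..T} z"
    using dz by (rule continuous_on_vector_derivative)
  have dz': "(z has_vector_derivative F (z s)) (at s within {0..t})"
    if "t \<le> T" "s \<in> {0..t}" "z s \<in> K" for s t
    using has_vector_derivative_within_subset[OF dz, of s "{0..t}"] that
    by (auto simp: closest_point_self)
  have inK: "z t \<in> interior K" if t: "t \<in> {0..T}" for t
  proof (rule ccontr)
    assume out: "z t \<notin> interior K"
    \<comment> \<open>The times spent outside the interior form a compact set, whose least element
      is the first exit time.\<close>
    define E where "E = {s \<in> {0..T}. z s \<in> - interior K}"
    have "closed ({0..T} \<inter> z -` (- interior K))"
      by (intro continuous_closed_preimage contz) auto
    moreover have "E = {0..T} \<inter> z -` (- interior K)" by (auto simp: E_def)
    ultimately have "closed E" by simp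
    have E: "t \<in> E" "E \<subseteq> {0..T}" using t out by (auto simp: E_def)
    have "compact E"
      using compact_Int_closed[OF compact_Icc \<open>closed E\<close>, of 0 T] E(2) by (simp add: Int_absorb1)
    then obtain s where s: "s \<in> E" "\<And>r. r \<in> E \<Longrightarrow> s \<le> r"
      using compact_attains_inf[of E] E by blast
    have before: "z r \<in> interior K" if "r \<in> {0..<s}" for r
      using s(2)[of r] that s(1) by (auto simp: E_def)
    have s0: "0 < s" using s(1) z z0 by (cases "s = 0") (auto simp: E_def)
    \<comment> \<open>Closedness of K carries membership over to the exit time itself. Up to and
      including s the curve then solves the original equation, and confinement puts
      \<open>z s\<close> back into the interior.\<close>
    have "z s \<in> K"
    proof -
      have "continuous (at s within {0..T}) z" using contz s(1) by (auto simp: E_def continuous_on_eq_continuous_within)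
      then have "(z \<longlongrightarrow> z s) (at s within {0..<s})"
        unfolding continuous_within by (rule tendsto_within_subset) (use s(1) in \<open>auto simp: E_def\<close>)
      moreover have "at s within {0..<s} \<noteq> bot"
        using s0 by (simp add: at_within_eq_bot_iff)
      moreover have "\<forall>\<^sub>F r in at s within {0..<s}. z r \<in> K"
        unfolding eventually_at_filter using before interior_subset by (intro always_eventually) blast
      ultimately show ?thesis using Lim_in_closed_set[OF K(2)] by blast
    qed
    then have "z r \<in> K" if "r \<in> {0..s}" for r
      using before[of r] that interior_subset by (cases "r = s") auto
    moreover have "s \<le> T" using s(1) by (auto simp: E_def)
    ultimately have "z s \<in> interior K"
      using s0 z dz' by (intro confined) auto
    then show False using s(1) by (simp add: E_def)
  qed
  then show ?thesis using z dz'[OF order_refl] interior_subset by blast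
qed

section \<open>Compactness\<close>

text \<open>In the application, on the sphere, u is U_{l1}, b the squared tangential gradient of
  U_{l1}, and a is -(l2 - l1) U_{l2}. A large multiple of b pays wherever the sign of a is unknown,
  and the margin \<epsilon> in u absorbs the higher terms of U.\<close>

lemma penalty_bounded_below:
  fixes a b u :: "'a::metric_space \<Rightarrow> real"
  assumes X: "compact X" and cont: "continuous_on X a" "continuous_on X b" "continuous_on X u"
    and b: "\<And>q. q \<in> X \<Longrightarrow> 0 \<le> b q"
    and pos: "\<And>q. \<lbrakk>q \<in> X; u q \<le> 0; b q = 0\<rbrakk> \<Longrightarrow> 0 < a q"
  shows "\<exists>A\<ge>0. \<exists>\<epsilon>>0. \<forall>q\<in>X. u q \<le> \<epsilon> \<longrightarrow> \<epsilon> \<le> a q + A * b q"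
proof -
  \<comment> \<open>The condition u <= 0 becomes a second penalty: \<open>b'\<close> vanishes
    exactly where u <= 0 and b = 0.\<close>
  define b' where "b' q = b q + max 0 (u q)" for q
  have contb': "continuous_on X b'" unfolding b'_def by (intro continuous_intros cont)
  have b'0: "0 \<le> b' q" if "q \<in> X" for q using b[OF that] by (simp add: b'_def)
  have pos': "0 < a q" if "q \<in> X" "b' q = 0" for q
    using pos[of q] b[of q] that by (auto simp: b'_def max_def split: if_splits)
  have "\<exists>A\<ge>0. \<forall>q\<in>X. 0 < a q + A * b' q"
  proof -
    define Z where "Z = {q \<in> X. a q \<le> 0}"
    have "closed (X \<inter> a -` {..0})"
      by (intro continuous_closed_preimage cont(1) compact_imp_closed[OF X] closed_atMost)
    moreover have "Z = X \<inter> (X \<inter> a -` {..0})" by (auto simp: Z_def)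
    ultimately have Z: "compact Z" using compact_Int_closed[OF X] by metis
    show ?thesis
    proof (cases "Z = {}")
      case True
      then show ?thesis by (intro exI[of _ 0]) (auto simp: Z_def not_le)
    next
      case False
      have ZX: "Z \<subseteq> X" by (auto simp: Z_def)
      obtain q0 where q0: "q0 \<in> Z" "\<And>q. q \<in> Z \<Longrightarrow> b' q0 \<le> b' q"
        using continuous_attains_inf[OF Z False continuous_on_subset[OF contb' ZX]] by blast
      obtain q1 where q1: "\<And>q. q \<in> Z \<Longrightarrow> a q1 \<le> a q"
        using continuous_attains_inf[OF Z False continuous_on_subset[OF cont(1) ZX]] by blast
      have \<beta>: "0 < b' q0"
        using q0(1) b'0[of q0] pos'[of q0] by (cases "b' q0 = 0") (auto simp: Z_def)
      \<comment> \<open>On \<open>Z\<close> the function a is at least \<open>a q1\<close> and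
        \<open>b'\<close> is at least \<open>b' q0\<close>, so this A lifts the sum to at least
        1.\<close>
      define A where "A = (\<bar>a q1\<bar> + 1) / b' q0"
      have A: "0 \<le> A" using \<beta> by (simp add: A_def)
      have "0 < a q + A * b' q" if "q \<in> X" for q
      proof (cases "q \<in> Z")
        case True
        have "\<bar>a q1\<bar> + 1 = A * b' q0" using \<beta> by (simp add: A_def)
        also have "\<dots> \<le> A * b' q" by (intro mult_left_mono q0 True A)
        finally show ?thesis using q1[OF True] by linarith
      next
        case False
        then have "0 < a q" using that by (simp add: Z_def)
        then show ?thesis using mult_nonneg_nonneg[OF A b'0[OF that]] by linarith
      qed
      with A show ?thesis by blast
    qed
  qed
  then obtain A where A: "0 \<le> A" "\<And>q. q \<in> X \<Longrightarrow> 0 < a q + A * b' q" by blast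
  have "\<exists>e>0. \<forall>q\<in>X. e \<le> a q + A * b' q"
  proof (cases "X = {}")
    case False
    have "continuous_on X (\<lambda>q. a q + A * b' q)" by (intro continuous_intros cont contb')
    from continuous_attains_inf[OF X False this] show ?thesis using A(2) by blast
  qed (auto intro: exI[of _ 1])
  then obtain e where e: "0 < e" "\<And>q. q \<in> X \<Longrightarrow> e \<le> a q + A * b' q" by blast
  \<comment> \<open>Dropping the penalty for u costs at most A \<epsilon> when u <= \<epsilon>;
    since e = (A + 1) \<epsilon>, a gain of \<epsilon> is left.\<close>
  define \<epsilon> where "\<epsilon> = e / (A + 1)"
  have \<epsilon>: "0 < \<epsilon>" using e(1) A(1) by (simp add: \<epsilon>_def)
  have "(A + 1) * \<epsilon> = e" using A(1) by (simp add: \<epsilon>_def)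
  then have eq: "e = A * \<epsilon> + \<epsilon>" by (simp add: distrib_right)
  have "\<epsilon> \<le> a q + A * b q" if "q \<in> X" "u q \<le> \<epsilon>" for q
  proof -
    have "A * max 0 (u q) \<le> A * \<epsilon>" using that \<epsilon> A(1) by (intro mult_left_mono) auto
    then show ?thesis using e(2)[OF that(1)] eq by (simp add: b'_def distrib_left)
  qed
  then show ?thesis using A(1) \<epsilon> by blast
qed

section \<open>The Euler--Lagrange field\<close>

lemma gradient_eqI: "(f has_derivative (\<lambda>h. g \<bullet> h)) (at x) \<Longrightarrow> gradient f x = g"
  unfolding gradient_def
proof (rule the_equality)
  assume f: "(f has_derivative (\<lambda>h. g \<bullet> h)) (at x)"
  then show "GDERIV f x :> g" by (simp add: gderiv_def inner_commute)
  fix g' assume "GDERIV f x :> g'"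
  then have "(f has_derivative (\<lambda>h. g' \<bullet> h)) (at x)" by (simp add: gderiv_def inner_commute)
  from has_derivative_unique[OF this f] have "g' \<bullet> h = g \<bullet> h" for h by meson
  then show "g' = g" using vector_eq_rdot by blast
qed

lemma riesz_eqI:
  assumes "\<And>w. l w = r \<bullet> w"
  shows "riesz l = r"
  unfolding riesz_def
proof (rule the_equality)
  fix r' assume "\<forall>w. l w = r' \<bullet> w"
  then have "\<forall>w. r' \<bullet> w = r \<bullet> w" using assms by simp
  then show "r' = r" unfolding vector_eq_rdot .
qed (simp add: assms)

text \<open>With \<open>s j\<close> the gradient of the j-th coefficient of the one-form, this is
  the Riesz dual of the contraction of its exterior derivative with v: the matrix J with rows
  \<open>s j\<close>, minus its transpose, applied to v.\<close>

definition magnetic :: "('n \<Rightarrow> real ^ 'n) \<Rightarrow> real ^ 'n \<Rightarrow> real ^ 'n::finite" where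
  "magnetic s v = (\<chi> j. s j \<bullet> v) - (\<Sum>j\<in>UNIV. v $ j *\<^sub>R s j)"

lemma magnetic_inner: "magnetic s v \<bullet> w = (\<Sum>j\<in>UNIV. (s j \<bullet> v) * w $ j - (s j \<bullet> w) * v $ j)"
  by (simp add: magnetic_def inner_diff_left inner_sum_left inner_vec_def[of "\<chi> j. s j \<bullet> v"]
      sum_subtractf mult_ac)

text \<open>Antisymmetry: the magnetic force does no work, which is why the energy is
  conserved.\<close>

lemma magnetic_inner_self: "magnetic s v \<bullet> v = 0"
  by (simp add: magnetic_inner)

lemma magnetic_diff_right: "magnetic s (v - w) = magnetic s v - magnetic s w"
  by (simp add: magnetic_def vec_eq_iff inner_diff_right scaleR_diff_left left_diff_distrib sum_subtractf)

lemma magnetic_diff_left: "magnetic (\<lambda>j. s j - s' j) v = magnetic s v - magnetic s' v"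
  by (simp add: magnetic_def vec_eq_iff inner_diff_left right_diff_distrib sum_subtractf)

lemma norm_magnetic_le: "norm (magnetic s v) \<le> 2 * (\<Sum>j\<in>UNIV. norm (s j)) * norm v"
proof -
  have "norm ((\<chi> j. s j \<bullet> v) :: real ^ 'a) \<le> (\<Sum>j\<in>UNIV. norm (s j) * norm v)"
    by (rule norm_vec_le) (simp add: Cauchy_Schwarz_ineq2)
  moreover have "norm (\<Sum>j\<in>UNIV. v $ j *\<^sub>R s j) \<le> (\<Sum>j\<in>UNIV. norm (s j) * norm v)"
    by (rule sum_norm_le) (simp add: mult.commute[of "norm (s _)"] mult_right_mono component_le_norm_cart)
  ultimately show ?thesis
    unfolding magnetic_def sum_distrib_right[symmetric]
    using norm_triangle_ineq4[of "(\<chi> j. s j \<bullet> v) :: real ^ 'a" "\<Sum>j\<in>UNIV. v $ j *\<^sub>R s j"] by linarith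
qed

text \<open>\<open>exterior_deriv\<close> differentiates \<sigma> as a map into a space of
  operators, while derivatives are given for the coefficients only; expanding \<sigma> in the dual
  basis transfers them.\<close>

lemma exterior_deriv_eq_magnetic:
  fixes \<sigma> :: "('n::finite) one_form"
  assumes "\<And>j. (form_coeff \<sigma> j has_derivative (\<lambda>h. s j \<bullet> h)) (at x)"
  shows "exterior_deriv \<sigma> x v w = magnetic s v \<bullet> w"
proof -
  let ?e = "\<lambda>j :: 'n. blinfun_inner_left (axis j (1 :: real))"
  have "\<sigma> y = (\<Sum>j\<in>UNIV. form_coeff \<sigma> j y *\<^sub>R ?e j)" for y
  proof (rule blinfun_eqI)
    fix h :: "real ^ 'n"
    have "blinfun_apply (\<sigma> y) h = blinfun_apply (\<sigma> y) (\<Sum>j\<in>UNIV. h $ j *\<^sub>R axis j 1)"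
      using basis_expansion[of h] by (simp add: scalar_mult_eq_scaleR)
    then show "blinfun_apply (\<sigma> y) h = blinfun_apply (\<Sum>j\<in>UNIV. form_coeff \<sigma> j y *\<^sub>R ?e j) h"
      by (simp add: blinfun.sum_right blinfun.sum_left blinfun.scaleR_left blinfun.scaleR_right
          form_coeff_def inner_axis mult.commute)
  qed
  then have "\<sigma> = (\<lambda>y. \<Sum>j\<in>UNIV. form_coeff \<sigma> j y *\<^sub>R ?e j)" by (rule ext)
  moreover have "((\<lambda>y. \<Sum>j\<in>UNIV. form_coeff \<sigma> j y *\<^sub>R ?e j) has_derivative
      (\<lambda>h. \<Sum>j\<in>UNIV. (s j \<bullet> h) *\<^sub>R ?e j)) (at x)"
    by (intro has_derivative_sum has_derivative_scaleR_left assms)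
  ultimately have "(\<sigma> has_derivative (\<lambda>h. \<Sum>j\<in>UNIV. (s j \<bullet> h) *\<^sub>R ?e j)) (at x)" by simp
  from frechet_derivative_at[OF this]
  have "frechet_derivative \<sigma> (at x) = (\<lambda>h. \<Sum>j\<in>UNIV. (s j \<bullet> h) *\<^sub>R ?e j)" by simp
  then show ?thesis
    by (simp add: exterior_deriv_def magnetic_inner blinfun.sum_left blinfun.scaleR_left inner_axis sum_subtractf)
qed

lemma powr_mult_power: "0 < r \<Longrightarrow> r powr s * r ^ k = r powr (s + real k)"
  by (simp add: powr_add powr_realpow)

section \<open>The correction of the radial field\<close>

text \<open>The factor \<open>r powr (m - a - 1)\<close> makes the pairing with the gradient of the form of degree
  \<open>a + 2\<close> homogeneous of degree \<open>a + m + 3\<close>.\<close>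

lemma tangential_field:
  fixes c :: "('n::finite \<Rightarrow> nat) \<Rightarrow> real" and a m :: nat
  defines "g \<equiv> form_gradient c (Suc a)"
  shows "\<exists>\<eta> \<eta>' C. 0 \<le> C \<and> (\<forall>x. x \<noteq> 0 \<longrightarrow>
    (\<eta> has_derivative \<eta>' x) (at x) \<and>
    norm (\<eta> x) \<le> C * norm x ^ (m + 2) \<and>
    (\<forall>h. norm (\<eta>' x h) \<le> C * norm x ^ (m + 1) * norm h) \<and>
    \<eta> x \<bullet> g x = norm x ^ (a + m + 3) * ((norm (g (sgn x)))\<^sup>2 - (g (sgn x) \<bullet> sgn x)\<^sup>2))"
proof -
  \<comment> \<open>P below has degree a + 3, so \<eta> has degree s + a + 3 = m + 2, which is l2 -
    l1 + 1 for l1 = a + 2 and l2 = a + m + 3. The exponent may be negative, hence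
    \<open>powr\<close> and the restriction to nonzero x.\<close>
  define s where "s = real m - real a - 1"
  define g' where "g' x h = (\<chi> i. form_gradient (partial_coeff i c) a x \<bullet> h)" for x h :: "real ^ 'n"
  \<comment> \<open>This is |x|^2 times the component of \<open>g x\<close> orthogonal to x; the
    factor |x|^2 keeps it polynomial.\<close>
  define P where "P x = (x \<bullet> x) *\<^sub>R g x - (g x \<bullet> x) *\<^sub>R x" for x
  define P' where "P' x h = (x \<bullet> x) *\<^sub>R g' x h + (2 * (x \<bullet> h)) *\<^sub>R g x
     - ((g x \<bullet> x) *\<^sub>R h + (g x \<bullet> h + g' x h \<bullet> x) *\<^sub>R x)" for x h
  define \<eta> where "\<eta> x = (norm x powr s) *\<^sub>R P x" for x
  define \<eta>' where "\<eta>' x h = (norm x powr s) *\<^sub>R P' x h + (s * norm x powr (s - 1) * (sgn x \<bullet> h)) *\<^sub>R P x" for x h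
  define C1 where "C1 = (\<Sum>i\<in>UNIV. coeff_mass (partial_coeff i c) (Suc a))"
  define C2 where "C2 = (\<Sum>i\<in>UNIV. \<Sum>j\<in>UNIV. coeff_mass (partial_coeff j (partial_coeff i c)) a)"
  have C: "0 \<le> C1" "0 \<le> C2" by (auto simp: C1_def C2_def intro!: sum_nonneg coeff_mass_nonneg)
  have dg: "(g has_derivative g' x) (at x)" for x
    unfolding g_def g'_def by (rule form_gradient_has_derivative)
  have ng: "norm (g x) \<le> C1 * norm x ^ (a + 1)" for x
    using norm_form_gradient_le[of c "Suc a" x] by (simp add: g_def C1_def)
  have ng': "norm (g' x h) \<le> C2 * norm x ^ a * norm h" for x h
    unfolding C2_def sum_distrib_right[of _ UNIV "norm x ^ a"] sum_distrib_right[of _ UNIV "norm h"]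
  proof -
    have "norm (g' x h) \<le> (\<Sum>i\<in>UNIV. (\<Sum>j\<in>UNIV. coeff_mass (partial_coeff j (partial_coeff i c)) a) * norm x ^ a * norm h)"
    proof (rule norm_vec_le)
      fix i
      have "\<bar>g' x h $ i\<bar> \<le> norm (form_gradient (partial_coeff i c) a x) * norm h"
        by (simp add: g'_def Cauchy_Schwarz_ineq2)
      also have "\<dots> \<le> (\<Sum>j\<in>UNIV. coeff_mass (partial_coeff j (partial_coeff i c)) a) * norm x ^ a * norm h"
        by (intro mult_right_mono norm_form_gradient_le) auto
      finally show "\<bar>g' x h $ i\<bar> \<le> (\<Sum>j\<in>UNIV. coeff_mass (partial_coeff j (partial_coeff i c)) a) * norm x ^ a * norm h" .
    qed
    then show "norm (g' x h) \<le> (\<Sum>i\<in>UNIV. \<Sum>j\<in>UNIV. coeff_mass (partial_coeff j (partial_coeff i c)) a * norm x ^ a * norm h)"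
      by (simp add: sum_distrib_right)
  qed
  have nP: "norm (P x) \<le> 2 * C1 * norm x ^ (a + 3)" for x
  proof -
    have "norm (P x) \<le> (norm x)\<^sup>2 * norm (g x) + \<bar>g x \<bullet> x\<bar> * norm x"
      unfolding P_def using norm_triangle_ineq4[of "(x \<bullet> x) *\<^sub>R g x" "(g x \<bullet> x) *\<^sub>R x"]
      by (simp add: dot_square_norm)
    also have "\<dots> \<le> (norm x)\<^sup>2 * norm (g x) + (norm (g x) * norm x) * norm x"
      by (intro add_left_mono mult_right_mono Cauchy_Schwarz_ineq2) auto
    also have "\<dots> = 2 * (norm x)\<^sup>2 * norm (g x)" by (simp add: power2_eq_square)
    also have "\<dots> \<le> 2 * (norm x)\<^sup>2 * (C1 * norm x ^ (a + 1))" by (intro mult_left_mono ng) auto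
    also have "\<dots> = 2 * C1 * norm x ^ (a + 3)" by (simp add: power2_eq_square eval_nat_numeral)
    finally show ?thesis .
  qed
  have nP': "norm (P' x h) \<le> (4 * C1 + 2 * C2) * norm x ^ (a + 2) * norm h" for x h
  proof -
    have xx: "\<bar>x \<bullet> x\<bar> = norm x * norm x" by (simp add: dot_square_norm power2_eq_square)
    have "norm (P' x h) \<le> norm ((x \<bullet> x) *\<^sub>R g' x h + (2 * (x \<bullet> h)) *\<^sub>R g x)
        + norm ((g x \<bullet> x) *\<^sub>R h + (g x \<bullet> h + g' x h \<bullet> x) *\<^sub>R x)"
      unfolding P'_def by (rule norm_triangle_ineq4)
    also have "\<dots> \<le> (norm ((x \<bullet> x) *\<^sub>R g' x h) + norm ((2 * (x \<bullet> h)) *\<^sub>R g x))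
        + (norm ((g x \<bullet> x) *\<^sub>R h) + norm ((g x \<bullet> h + g' x h \<bullet> x) *\<^sub>R x))"
      by (intro add_mono norm_triangle_ineq)
    also have "\<dots> = norm x * norm x * norm (g' x h) + 2 * \<bar>x \<bullet> h\<bar> * norm (g x)
        + \<bar>g x \<bullet> x\<bar> * norm h + \<bar>g x \<bullet> h + g' x h \<bullet> x\<bar> * norm x"
      by (simp only: norm_scaleR xx abs_mult abs_numeral)
    also have "\<dots> \<le> norm x * norm x * norm (g' x h) + 2 * (norm x * norm h) * norm (g x)
        + (norm (g x) * norm x) * norm h + (norm (g x) * norm h + norm (g' x h) * norm x) * norm x"
      by (intro add_mono mult_right_mono mult_left_mono Cauchy_Schwarz_ineq2 order_trans[OF abs_triangle_ineq]) auto
    also have "\<dots> = 4 * (norm x * norm h) * norm (g x) + 2 * (norm x * norm x) * norm (g' x h)"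
      by (simp add: algebra_simps)
    also have "\<dots> \<le> 4 * (norm x * norm h) * (C1 * norm x ^ (a + 1))
        + 2 * (norm x * norm x) * (C2 * norm x ^ a * norm h)"
      by (intro add_mono mult_left_mono ng ng') auto
    also have "\<dots> = (4 * C1 + 2 * C2) * norm x ^ (a + 2) * norm h"
      by (simp add: algebra_simps)
    finally show ?thesis .
  qed
  \<comment> \<open>The summand 4 C1 + 2 C2 bounds P', and 2 |s| C1 comes from differentiating the
    power of the norm.\<close>
  define C where "C = 2 * \<bar>s\<bar> * C1 + 4 * C1 + 2 * C2"
  have "0 \<le> C" using C by (simp add: C_def)
  moreover have "(\<eta> has_derivative \<eta>' x) (at x)" if "x \<noteq> 0" for x
  proof -
    have dP: "(P has_derivative P' x) (at x)"
      unfolding P_def P'_def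
      by (rule has_derivative_eq_rhs, (rule dg derivative_intros)+)
        (auto simp: algebra_simps inner_commute)
    have "((\<lambda>x. norm x powr s) has_derivative (\<lambda>h. s * norm x powr (s - 1) * (sgn x \<bullet> h))) (at x)"
      by (rule has_derivative_eq_rhs[OF has_derivative_powr[OF has_derivative_norm has_derivative_const]])
        (use that in \<open>auto simp: powr_diff inner_commute\<close>)
    from has_derivative_scaleR[OF this dP] show ?thesis
      by (simp add: \<eta>_def[abs_def] \<eta>'_def[abs_def])
  qed
  moreover have "norm (\<eta> x) \<le> C * norm x ^ (m + 2)" if "x \<noteq> 0" for x
  proof -
    have "norm (\<eta> x) \<le> norm x powr s * (2 * C1 * norm x ^ (a + 3))"
      unfolding \<eta>_def norm_scaleR by (intro mult_mono nP) auto
    also have "\<dots> = 2 * C1 * (norm x powr s * norm x ^ (a + 3))" by simp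
    also have "norm x powr s * norm x ^ (a + 3) = norm x powr real (m + 2)"
      using that by (subst powr_mult_power) (auto simp: s_def algebra_simps)
    also have "\<dots> = norm x ^ (m + 2)" using that by (subst powr_realpow) auto
    also have "2 * C1 * norm x ^ (m + 2) \<le> C * norm x ^ (m + 2)"
      using C by (intro mult_right_mono) (auto simp: C_def)
    finally show ?thesis .
  qed
  moreover have "norm (\<eta>' x h) \<le> C * norm x ^ (m + 1) * norm h" if "x \<noteq> 0" for x h
  proof -
    have n1: "\<bar>sgn x \<bullet> h\<bar> \<le> norm h"
      using Cauchy_Schwarz_ineq2[of "sgn x" h] that by (simp add: norm_sgn)
    have "norm (\<eta>' x h) \<le> norm x powr s * norm (P' x h) + (\<bar>s\<bar> * norm x powr (s - 1) * \<bar>sgn x \<bullet> h\<bar>) * norm (P x)"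
      unfolding \<eta>'_def by (rule order_trans[OF norm_triangle_ineq]) (simp add: abs_mult)
    also have "\<dots> \<le> norm x powr s * ((4 * C1 + 2 * C2) * norm x ^ (a + 2) * norm h) +
        (\<bar>s\<bar> * norm x powr (s - 1) * norm h) * (2 * C1 * norm x ^ (a + 3))"
      using C by (intro add_mono mult_left_mono mult_mono nP nP' n1) auto
    also have "\<dots> = ((4 * C1 + 2 * C2) * (norm x powr s * norm x ^ (a + 2)) +
        2 * \<bar>s\<bar> * C1 * (norm x powr (s - 1) * norm x ^ (a + 3))) * norm h"
      by (simp add: algebra_simps)
    also have "norm x powr s * norm x ^ (a + 2) = norm x powr real (m + 1)"
      using that by (subst powr_mult_power) (auto simp: s_def algebra_simps)
    also have "norm x powr (s - 1) * norm x ^ (a + 3) = norm x powr real (m + 1)"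
      using that by (subst powr_mult_power) (auto simp: s_def algebra_simps)
    also have "norm x powr real (m + 1) = norm x ^ (m + 1)" using that by (subst powr_realpow) auto
    finally show ?thesis by (simp add: C_def algebra_simps)
  qed
  moreover have "\<eta> x \<bullet> g x = norm x ^ (a + m + 3) * ((norm (g (sgn x)))\<^sup>2 - (g (sgn x) \<bullet> sgn x)\<^sup>2)"
    if "x \<noteq> 0" for x
  proof -
    define r where "r = norm x"
    define q where "q = sgn x"
    have r: "0 < r" and x: "x = r *\<^sub>R q" using that by (auto simp: r_def q_def sgn_div_norm)
    have gx: "g x = r ^ (a + 1) *\<^sub>R g q" unfolding g_def x by (simp add: form_gradient_scaleR)
    have q: "q \<bullet> q = 1" using that by (simp add: q_def dot_square_norm norm_sgn)
    have "\<eta> x \<bullet> g x = r powr s * ((x \<bullet> x) * (g x \<bullet> g x) - (g x \<bullet> x) * (g x \<bullet> x))"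
      by (simp add: \<eta>_def P_def r_def inner_diff_left inner_commute[of x "g x"])
    also have "\<dots> = (r powr s * r ^ (2 * a + 4)) * (g q \<bullet> g q - (g q \<bullet> q)\<^sup>2)"
      unfolding gx unfolding x by (simp add: q power2_eq_square algebra_simps mult_2 power_add eval_nat_numeral)
    also have "r powr s * r ^ (2 * a + 4) = r powr real (a + m + 3)"
      using r by (subst powr_mult_power) (auto simp: s_def algebra_simps)
    also have "\<dots> = r ^ (a + m + 3)" using r by (subst powr_realpow) auto
    finally show ?thesis by (simp add: r_def q_def dot_square_norm)
  qed
  ultimately show ?thesis by blast
qed

section \<open>The Lyapunov estimate\<close>

text \<open>Writing l1 = a + 2 and l2 = a + m + 3 builds in 2 <= l1 < l2 without subtraction; the
  gradients of the two forms have degrees a + 1 and a + m + 2. \<open>R\<close> is the magnetic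
  force, of order k at the origin. The bound to be proved is on the derivative of Y(x) . v along the
  flow.\<close>

lemma lyapunov_field:
  fixes c :: "('n::finite \<Rightarrow> nat) \<Rightarrow> real" and a m k :: nat
    and U :: "real ^ 'n \<Rightarrow> real" and g :: "real ^ 'n \<Rightarrow> real ^ 'n" and R :: "real ^ 'n \<Rightarrow> real ^ 'n \<Rightarrow> real ^ 'n"
  defines "u1 \<equiv> hom_form c (a + 2)" and "u2 \<equiv> hom_form c (a + m + 3)"
    and "g1 \<equiv> form_gradient c (Suc a)" and "g2 \<equiv> form_gradient c (a + m + 2)"
  assumes \<rho>: "0 < \<rho>" and U0: "U 0 = 0"
    and E: "0 \<le> CE" "\<And>x. x \<in> ball 0 \<rho> \<Longrightarrow> \<bar>U x - (u1 x + u2 x)\<bar> \<le> CE * norm x ^ (a + m + 4)"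
    and e: "0 \<le> Ce" "\<And>x. x \<in> ball 0 \<rho> \<Longrightarrow> norm (g x - (g1 x + g2 x)) \<le> Ce * norm x ^ (a + m + 3)"
    and R: "0 \<le> CR" "\<And>x v. x \<in> ball 0 \<rho> \<Longrightarrow> norm (R x v) \<le> CR * norm x ^ k * norm v"
    and k: "a + m + 4 \<le> 2 * k + 2"
    and crit: "\<And>q. \<lbrakk>norm q = 1; u1 q \<le> 0; (norm (g1 q))\<^sup>2 - (g1 q \<bullet> q)\<^sup>2 = 0\<rbrakk> \<Longrightarrow> u2 q < 0"
  shows "\<exists>\<rho>'>0. \<exists>Y Y' M. \<rho>' \<le> \<rho> \<and> (\<forall>x\<in>ball 0 \<rho>'. U x < 0 \<longrightarrow>
    (Y has_derivative Y' x) (at x) \<and> norm (Y x) \<le> M \<and>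
    (\<forall>v. - real (a + 2) * U x \<le> Y' x v \<bullet> v + Y x \<bullet> (- g x - R x v)))"
proof -
  define n where "n = a + m + 3"
  obtain \<eta> \<eta>' C where C: "0 \<le> C"
    and d\<eta>: "\<And>x. x \<noteq> 0 \<Longrightarrow> (\<eta> has_derivative \<eta>' x) (at x)"
    and n\<eta>: "\<And>x. x \<noteq> 0 \<Longrightarrow> norm (\<eta> x) \<le> C * norm x ^ (m + 2)"
    and n\<eta>': "\<And>x h. x \<noteq> 0 \<Longrightarrow> norm (\<eta>' x h) \<le> C * norm x ^ (m + 1) * norm h"
    and \<eta>g: "\<And>x. x \<noteq> 0 \<Longrightarrow> \<eta> x \<bullet> g1 x = norm x ^ n * ((norm (g1 (sgn x)))\<^sup>2 - (g1 (sgn x) \<bullet> sgn x)\<^sup>2)"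
    using tangential_field[where c = c and a = a and m = m] unfolding g1_def n_def by blast
  have "\<exists>A\<ge>0. \<exists>\<epsilon>>0. \<forall>q\<in>sphere 0 1. u1 q \<le> \<epsilon> \<longrightarrow>
      \<epsilon> \<le> - real (m + 1) * u2 q + A * ((norm (g1 q))\<^sup>2 - (g1 q \<bullet> q)\<^sup>2)"
  proof (rule penalty_bounded_below)
    fix q :: "real ^ 'n" assume q: "q \<in> sphere 0 1"
    have "(g1 q \<bullet> q)\<^sup>2 \<le> (norm (g1 q))\<^sup>2"
      using Cauchy_Schwarz_ineq[of "g1 q" q] q by (simp add: dot_square_norm)
    then show "0 \<le> (norm (g1 q))\<^sup>2 - (g1 q \<bullet> q)\<^sup>2" by simp
    assume "u1 q \<le> 0" "(norm (g1 q))\<^sup>2 - (g1 q \<bullet> q)\<^sup>2 = 0"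
    then have "u2 q < 0" using crit q by simp
    then show "0 < - real (m + 1) * u2 q" by (intro mult_neg_neg) auto
  qed (auto simp: u1_def u2_def g1_def intro!: continuous_intros continuous_on_hom_form continuous_on_form_gradient)
  then obtain A \<epsilon> where A: "0 \<le> A" and \<epsilon>: "0 < \<epsilon>" and A\<epsilon>: "\<And>q. \<lbrakk>norm q = 1; u1 q \<le> \<epsilon>\<rbrakk> \<Longrightarrow>
      \<epsilon> \<le> - real (m + 1) * u2 q + A * ((norm (g1 q))\<^sup>2 - (g1 q \<bullet> q)\<^sup>2)"
    by auto
  define N2 where "N2 = coeff_mass c n"
  define G2 where "G2 = (\<Sum>i\<in>UNIV. coeff_mass (partial_coeff i c) (a + m + 2))"
  have N2: "0 \<le> N2" "\<And>x. \<bar>u2 x\<bar> \<le> N2 * norm x ^ n"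
    unfolding N2_def u2_def n_def by (auto intro: coeff_mass_nonneg abs_hom_form_le)
  have G2: "0 \<le> G2" "\<And>x. norm (g2 x) \<le> G2 * norm x ^ (a + m + 2)"
    unfolding G2_def g2_def by (intro sum_nonneg coeff_mass_nonneg norm_form_gradient_le)+
  \<comment> \<open>B r^(k+1) |v| bounds the magnetic contribution. D collects the coefficients of
    all errors of order r^(n+1): the remainders of U and of its gradient, the pairing of \<eta> with
    the higher part of the gradient, and the magnetic term after Young's inequality.\<close>
  define B where "B = (1 + A * C) * CR"
  define D where "D = real (a + 2) * CE + Ce + A * C * (G2 + Ce) + B\<^sup>2"
  have AC: "0 \<le> A * C" using A C by simp
  have D: "0 \<le> D" using E(1) e(1) AC G2(1) by (simp add: D_def)
  \<comment> \<open>Radius 1 makes powers of r decrease with the exponent; the third bound limits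
    the cost of the derivative of A \<eta> to |v|^2/4; the fourth gives D r <= \<epsilon>; the last
    makes U < 0 force \<open>u1 q \<le> \<epsilon>\<close>. Each added 1 keeps a denominator
    positive.\<close>
  define \<rho>' where "\<rho>' = Min {\<rho>, 1, 1 / (4 * (A * C + 1)), \<epsilon> / (D + 1), \<epsilon> / (N2 + CE + 1)}"
  have "0 < \<rho>'" using \<rho> AC \<epsilon> D N2(1) E(1) by (auto simp: \<rho>'_def intro!: divide_pos_pos)
  have \<rho>'_le: "\<rho>' \<le> \<rho>" "\<rho>' \<le> 1" "\<rho>' \<le> 1 / (4 * (A * C + 1))" "\<rho>' \<le> \<epsilon> / (D + 1)" "\<rho>' \<le> \<epsilon> / (N2 + CE + 1)"
    by (auto simp: \<rho>'_def)
  define Y where "Y x = x - A *\<^sub>R \<eta> x" for x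
  define Y' where "Y' x h = h - A *\<^sub>R \<eta>' x h" for x h
  have main: "(Y has_derivative Y' x) (at x) \<and> norm (Y x) \<le> 1 + A * C \<and>
    (\<forall>v. - real (a + 2) * U x \<le> Y' x v \<bullet> v + Y x \<bullet> (- g x - R x v))"
    if x: "x \<in> ball 0 \<rho>'" and neg: "U x < 0" for x
  proof -
    define r where "r = norm x"
    define q where "q = sgn x"
    have x0: "x \<noteq> 0" using neg U0 by auto
    have r: "0 < r" "r < \<rho>'" using x x0 by (auto simp: r_def)
    have x\<rho>: "x \<in> ball 0 \<rho>" using x \<rho>'_le by simp
    have r1: "r \<le> 1" using r \<rho>'_le by linarith
    have rAC: "A * C * r \<le> 1/4"
    proof -
      have "(4 * (A * C + 1)) * r \<le> (4 * (A * C + 1)) * (1 / (4 * (A * C + 1)))"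
        using AC by (intro mult_left_mono order_trans[OF less_imp_le[OF r(2)] \<rho>'_le(3)]) simp
      also have "\<dots> = 1" using AC by simp
      finally show ?thesis using r by (simp add: algebra_simps)
    qed
    have rD: "D * r \<le> \<epsilon>"
    proof -
      have "(D + 1) * r \<le> (D + 1) * (\<epsilon> / (D + 1))"
        using r \<rho>'_le D by (intro mult_left_mono) linarith+
      also have "\<dots> = \<epsilon>" using D by simp
      finally show ?thesis using r by (simp add: algebra_simps)
    qed
    have rN: "(N2 + CE) * r \<le> \<epsilon>"
    proof -
      have "(N2 + CE + 1) * r \<le> (N2 + CE + 1) * (\<epsilon> / (N2 + CE + 1))"
        using r \<rho>'_le N2(1) E(1) by (intro mult_left_mono) linarith+
      also have "\<dots> = \<epsilon>" using N2(1) E(1) by simp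
      finally show ?thesis using r by (simp add: algebra_simps)
    qed
    have pow_le: "r ^ j \<le> r ^ i" if "i \<le> j" for i j
      using r(1) r1 that by (intro power_decreasing) auto
    have pow_le_r: "r ^ (m + 1) \<le> r" using pow_le[of 1 "m + 1"] by simp
    have q: "norm q = 1" and xq: "x = r *\<^sub>R q"
      using x0 by (auto simp: q_def r_def norm_sgn sgn_div_norm)
    define \<xi> where "\<xi> = U x - (u1 x + u2 x)"
    define \<zeta> where "\<zeta> = g x - (g1 x + g2 x)"
    have \<xi>: "\<bar>\<xi>\<bar> \<le> CE * (r ^ n * r)"
      using E(2)[OF x\<rho>] by (simp add: \<xi>_def r_def n_def eval_nat_numeral mult_ac)
    have \<zeta>: "norm \<zeta> \<le> Ce * r ^ n"
      using e(2)[OF x\<rho>] by (simp add: \<zeta>_def r_def n_def)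
    \<comment> \<open>From U < 0, u1 at x is at most (N2 + CE) r^n; division by r^(a+2) leaves
      r^(m+1) <= r.\<close>
    have u1q: "u1 q \<le> \<epsilon>"
    proof -
      have "r ^ n * r \<le> r ^ n" using r(1) r1 by (simp add: mult_left_le)
      then have "CE * (r ^ n * r) \<le> CE * r ^ n" by (rule mult_left_mono) (rule E(1))
      moreover have "u1 x = U x - \<xi> - u2 x" by (simp add: \<xi>_def)
      ultimately have "u1 x \<le> (N2 + CE) * r ^ n"
        using neg \<xi> N2(2)[of x] unfolding r_def[symmetric] distrib_right by linarith
      moreover have "u1 x = r ^ (a + 2) * u1 q" unfolding u1_def xq by (rule hom_form_scaleR)
      ultimately have "r ^ (a + 2) * u1 q \<le> r ^ (a + 2) * ((N2 + CE) * r ^ (m + 1))"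
        by (simp add: n_def power_add eval_nat_numeral mult_ac)
      then have "u1 q \<le> (N2 + CE) * r ^ (m + 1)" using r(1) by simp
      also have "\<dots> \<le> (N2 + CE) * r" using pow_le_r N2(1) E(1) by (intro mult_left_mono) auto
      finally show ?thesis using rN by linarith
    qed
    have f6: "\<epsilon> * r ^ n \<le> - real (m + 1) * u2 x + A * (\<eta> x \<bullet> g1 x)"
    proof -
      have e1: "u2 x = r ^ n * u2 q" unfolding u2_def n_def by (subst xq) (rule hom_form_scaleR)
      have e2: "\<eta> x \<bullet> g1 x = r ^ n * ((norm (g1 q))\<^sup>2 - (g1 q \<bullet> q)\<^sup>2)"
        using \<eta>g[OF x0] by (simp add: r_def q_def)
      have "\<epsilon> * r ^ n \<le> (- real (m + 1) * u2 q + A * ((norm (g1 q))\<^sup>2 - (g1 q \<bullet> q)\<^sup>2)) * r ^ n"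
        using A\<epsilon>[OF q u1q] r(1) by (intro mult_right_mono) auto
      then show ?thesis unfolding e1 e2 by (simp add: algebra_simps)
    qed
    \<comment> \<open>The degrees add up to (m + 2) + (a + m + 2) = n + m + 1, at least one more
      than n.\<close>
    have f4: "A * \<bar>\<eta> x \<bullet> (g2 x + \<zeta>)\<bar> \<le> A * C * (G2 + Ce) * (r ^ n * r)"
    proof -
      have "Ce * r ^ n \<le> Ce * r ^ (a + m + 2)"
        by (intro mult_left_mono e pow_le) (simp add: n_def)
      then have "norm (g2 x + \<zeta>) \<le> (G2 + Ce) * r ^ (a + m + 2)"
        using norm_triangle_ineq[of "g2 x" \<zeta>] G2(2)[of x] \<zeta> unfolding r_def[symmetric] distrib_right by linarith
      then have "norm (\<eta> x) * norm (g2 x + \<zeta>) \<le> (C * r ^ (m + 2)) * ((G2 + Ce) * r ^ (a + m + 2))"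
        using n\<eta>[OF x0] C r(1) by (intro mult_mono) (auto simp: r_def)
      also have "\<dots> = C * (G2 + Ce) * (r ^ ((m + 2) + (a + m + 2)))"
        by (simp only: power_add mult_ac)
      also have "\<dots> \<le> C * (G2 + Ce) * (r ^ (n + 1))"
        using C G2(1) e(1) by (intro mult_left_mono pow_le) (auto simp: n_def)
      finally have "norm (\<eta> x) * norm (g2 x + \<zeta>) \<le> C * (G2 + Ce) * (r ^ n * r)" by (simp add: mult_ac)
      then have "\<bar>\<eta> x \<bullet> (g2 x + \<zeta>)\<bar> \<le> C * (G2 + Ce) * (r ^ n * r)"
        using Cauchy_Schwarz_ineq2[of "\<eta> x" "g2 x + \<zeta>"] by linarith
      then have "A * \<bar>\<eta> x \<bullet> (g2 x + \<zeta>)\<bar> \<le> A * (C * (G2 + Ce) * (r ^ n * r))"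
        by (rule mult_left_mono) (rule A)
      then show ?thesis by (simp add: mult_ac)
    qed
    have f3: "\<bar>x \<bullet> \<zeta>\<bar> \<le> Ce * (r ^ n * r)"
    proof -
      have "\<bar>x \<bullet> \<zeta>\<bar> \<le> r * norm \<zeta>" unfolding r_def by (rule Cauchy_Schwarz_ineq2)
      also have "\<dots> \<le> r * (Ce * r ^ n)" using \<zeta> r(1) by (intro mult_left_mono) auto
      finally show ?thesis by (simp add: mult_ac)
    qed
    have nY: "norm (Y x) \<le> (1 + A * C) * r"
    proof -
      have "norm (\<eta> x) \<le> C * r ^ (m + 2)" using n\<eta>[OF x0] by (simp add: r_def)
      also have "\<dots> \<le> C * r ^ 1" by (intro mult_left_mono pow_le C) auto
      finally have "A * norm (\<eta> x) \<le> A * (C * r ^ 1)" by (rule mult_left_mono) (rule A)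
      then show ?thesis
        using norm_triangle_ineq4[of x "A *\<^sub>R \<eta> x"] A by (simp add: Y_def r_def algebra_simps)
    qed
    have bound: "- real (a + 2) * U x \<le> Y' x v \<bullet> v + Y x \<bullet> (- g x - R x v)" for v
    proof -
      define w where "w = norm v"
      have f1: "A * \<bar>\<eta>' x v \<bullet> v\<bar> \<le> w\<^sup>2 / 4"
      proof -
        have "\<bar>\<eta>' x v \<bullet> v\<bar> \<le> norm (\<eta>' x v) * w" unfolding w_def by (rule Cauchy_Schwarz_ineq2)
        also have "\<dots> \<le> (C * r ^ (m + 1) * w) * w"
          using n\<eta>'[OF x0, of v] by (intro mult_right_mono) (auto simp: r_def w_def)
        also have "\<dots> \<le> (C * r * w) * w"
          by (intro mult_right_mono mult_left_mono pow_le_r C) (auto simp: w_def)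
        finally have "A * \<bar>\<eta>' x v \<bullet> v\<bar> \<le> A * ((C * r * w) * w)" by (rule mult_left_mono) (rule A)
        also have "\<dots> = (A * C * r) * w\<^sup>2" by (simp add: power2_eq_square)
        also have "\<dots> \<le> 1/4 * w\<^sup>2" by (intro mult_right_mono rAC) auto
        finally show ?thesis by simp
      qed
      \<comment> \<open>Young's inequality p w <= w^2/4 + p^2, where p^2 has order 2 (k + 1) >= n +
        1 by the hypothesis on k.\<close>
      have f5: "\<bar>Y x \<bullet> R x v\<bar> \<le> w\<^sup>2 / 4 + B\<^sup>2 * (r ^ n * r)"
      proof -
        define p where "p = B * r ^ (k + 1)"
        have "\<bar>Y x \<bullet> R x v\<bar> \<le> norm (Y x) * norm (R x v)" by (rule Cauchy_Schwarz_ineq2)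
        also have "\<dots> \<le> ((1 + A * C) * r) * (CR * r ^ k * w)"
          using R(2)[OF x\<rho>, of v] nY AC r(1) by (intro mult_mono) (auto simp: r_def w_def)
        also have "\<dots> = p * w" by (simp add: p_def B_def)
        also have "\<dots> \<le> w\<^sup>2 / 4 + p\<^sup>2"
          using zero_le_power2[of "w / 2 - p"] by (simp add: power2_diff power_divide mult.commute)
        also have "p\<^sup>2 = B\<^sup>2 * r ^ ((k + 1) * 2)" unfolding p_def power_mult_distrib power_mult ..
        also have "\<dots> \<le> B\<^sup>2 * r ^ (n + 1)" using k by (intro mult_left_mono pow_le) (auto simp: n_def)
        finally show ?thesis by (simp add: mult_ac)
      qed
      have e1: "x \<bullet> g1 x = real (a + 2) * u1 x"
        using form_gradient_inner_self[of c "Suc a" x] by (simp add: g1_def u1_def inner_commute)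
      have e2: "x \<bullet> g2 x = real (a + m + 3) * u2 x"
        using form_gradient_inner_self[of c "a + m + 2" x]
        by (simp add: g2_def u2_def inner_commute eval_nat_numeral)
      have gx: "g x = g1 x + g2 x + \<zeta>" by (simp add: \<zeta>_def)
      have xg: "x \<bullet> g x = real (a + 2) * (U x - \<xi>) + real (m + 1) * u2 x + x \<bullet> \<zeta>"
        unfolding gx by (simp add: inner_add_right e1 e2 \<xi>_def algebra_simps)
      have "Y' x v \<bullet> v + Y x \<bullet> (- g x - R x v) = w\<^sup>2 - A * (\<eta>' x v \<bullet> v) - x \<bullet> g x + A * (\<eta> x \<bullet> g x) - Y x \<bullet> R x v"
        by (simp add: Y'_def Y_def w_def inner_diff_left inner_diff_right dot_square_norm)
      also have "\<dots> = w\<^sup>2 - A * (\<eta>' x v \<bullet> v) - real (a + 2) * U x + real (a + 2) * \<xi> - x \<bullet> \<zeta>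
          + (- real (m + 1) * u2 x + A * (\<eta> x \<bullet> g1 x)) + A * (\<eta> x \<bullet> (g2 x + \<zeta>)) - Y x \<bullet> R x v"
        unfolding xg by (simp add: gx inner_add_right algebra_simps)
      finally have eq: "Y' x v \<bullet> v + Y x \<bullet> (- g x - R x v) = \<dots>" .
      have "\<bar>real (a + 2) * \<xi>\<bar> \<le> real (a + 2) * (CE * (r ^ n * r))"
        unfolding abs_mult by (intro mult_mono \<xi>) auto
      moreover have "\<bar>A * (\<eta>' x v \<bullet> v)\<bar> = A * \<bar>\<eta>' x v \<bullet> v\<bar>" "\<bar>A * (\<eta> x \<bullet> (g2 x + \<zeta>))\<bar> = A * \<bar>\<eta> x \<bullet> (g2 x + \<zeta>)\<bar>"
        using A by (simp_all add: abs_mult)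
      moreover have "D * (r ^ n * r) \<le> \<epsilon> * r ^ n"
        using mult_right_mono[OF rD, of "r ^ n"] r(1) by (simp add: mult_ac)
      moreover have "D * (r ^ n * r) = real (a + 2) * (CE * (r ^ n * r)) + Ce * (r ^ n * r)
          + A * C * (G2 + Ce) * (r ^ n * r) + B\<^sup>2 * (r ^ n * r)"
        by (simp add: D_def algebra_simps)
      moreover have "0 \<le> w\<^sup>2" by simp
      \<comment> \<open>The correction and the magnetic term each take a quarter of |v|^2, and the
        gain \<epsilon> r^n covers all errors D r^(n+1).\<close>
      ultimately show ?thesis using f1 f3 f4 f5 f6 unfolding eq by linarith
    qed
    have "(Y has_derivative Y' x) (at x)"
      unfolding Y_def[abs_def] Y'_def[abs_def] by (intro derivative_intros d\<eta> x0)
    moreover have "norm (Y x) \<le> 1 + A * C"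
      using order_trans[OF nY mult_left_le[OF r1]] AC by simp
    ultimately show ?thesis using bound by blast
  qed
  show ?thesis
    using \<open>0 < \<rho>'\<close> \<rho>'_le(1) main by (intro exI[of _ \<rho>'] exI[of _ Y] exI[of _ Y'] exI[of _ "1 + A * C"] conjI) auto
qed

section \<open>Total instability\<close>

text \<open>The force is bilinear in \<open>s\<close> and v, so its increment splits into one in v
  with coefficients bounded by C and one in the coefficients with |v| <= V. The latter is why the
  velocity must be bounded.\<close>

lemma lipschitz_on_magnetic:
  fixes s :: "'n::finite \<Rightarrow> real ^ 'n \<Rightarrow> real ^ 'n"
  assumes L: "\<And>j. L-lipschitz_on X (s j)" and C: "\<And>x j. x \<in> X \<Longrightarrow> norm (s j x) \<le> C" "0 \<le> C" and V: "0 \<le> V"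
  shows "(2 * real CARD('n) * (C + L * V))-lipschitz_on (X \<times> cball 0 V) (\<lambda>(x, v). magnetic (\<lambda>j. s j x) v)"
proof (rule lipschitz_onI)
  have L0: "0 \<le> L" using L by (rule lipschitz_on_nonneg)
  then show "0 \<le> 2 * real CARD('n) * (C + L * V)" using C V by simp
  fix z w :: "(real ^ 'n) \<times> (real ^ 'n)"
  assume zw: "z \<in> X \<times> cball 0 V" "w \<in> X \<times> cball 0 V"
  obtain x v y u where z: "z = (x, v)" and w: "w = (y, u)" by (metis surj_pair)
  have x: "x \<in> X" "y \<in> X" and u: "norm u \<le> V" using zw by (auto simp: z w)
  have "norm (magnetic (\<lambda>j. s j x) (v - u)) \<le> 2 * (\<Sum>j\<in>UNIV. norm (s j x)) * norm (v - u)"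
    by (rule norm_magnetic_le)
  also have "\<dots> \<le> 2 * (\<Sum>j\<in>(UNIV :: 'n set). C) * dist z w"
    using dist_snd_le[of z w] C(2)
    by (intro mult_mono sum_mono C x mult_left_mono) (auto simp: z w dist_norm intro: sum_nonneg)
  finally have 1: "norm (magnetic (\<lambda>j. s j x) (v - u)) \<le> 2 * real CARD('n) * C * dist z w" by simp
  have "norm (s j x - s j y) \<le> L * dist z w" for j
  proof -
    have "norm (s j x - s j y) \<le> L * dist x y"
      using lipschitz_onD[OF L x] by (simp add: dist_norm)
    also have "\<dots> \<le> L * dist z w" using dist_fst_le[of z w] L0 by (intro mult_left_mono) (auto simp: z w)
    finally show ?thesis .
  qed
  then have "(\<Sum>j\<in>UNIV. norm (s j x - s j y)) \<le> (\<Sum>j\<in>(UNIV :: 'n set). L * dist z w)"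
    by (rule sum_mono)
  then have "2 * (\<Sum>j\<in>UNIV. norm (s j x - s j y)) * norm u \<le> 2 * (\<Sum>j\<in>(UNIV :: 'n set). L * dist z w) * V"
    using u L0 by (intro mult_mono mult_left_mono) auto
  then have 2: "norm (magnetic (\<lambda>j. s j x - s j y) u) \<le> 2 * real CARD('n) * L * V * dist z w"
    using norm_magnetic_le[of "\<lambda>j. s j x - s j y" u] by (simp add: mult_ac)
  have "magnetic (\<lambda>j. s j x) v - magnetic (\<lambda>j. s j y) u =
      magnetic (\<lambda>j. s j x) (v - u) + magnetic (\<lambda>j. s j x - s j y) u"
    by (simp add: magnetic_diff_left magnetic_diff_right)
  then have "dist (magnetic (\<lambda>j. s j x) v) (magnetic (\<lambda>j. s j y) u) \<le>
      norm (magnetic (\<lambda>j. s j x) (v - u)) + norm (magnetic (\<lambda>j. s j x - s j y) u)"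
    by (simp add: dist_norm norm_triangle_ineq)
  with 1 2 show "dist (case z of (x, v) \<Rightarrow> magnetic (\<lambda>j. s j x) v) (case w of (x, v) \<Rightarrow> magnetic (\<lambda>j. s j x) v)
      \<le> 2 * real CARD('n) * (C + L * V) * dist z w"
    by (simp add: z w distrib_left distrib_right mult_ac)
qed

text \<open>The difference is the squared length of the part of the gradient tangent to the sphere;
  when it vanishes, the gradient is a multiple of q.\<close>

lemma sphere_critical_pointI:
  assumes "norm q = 1" and "(norm (form_gradient c k q))\<^sup>2 - (form_gradient c k q \<bullet> q)\<^sup>2 = 0"
  shows "sphere_critical_point (hom_form c (Suc k)) q"
proof -
  define g where "g = form_gradient c k q"
  have "(norm (g - (g \<bullet> q) *\<^sub>R q))\<^sup>2 = (norm g)\<^sup>2 - 2 * (g \<bullet> q) * (g \<bullet> q) + (g \<bullet> q)\<^sup>2 * (q \<bullet> q)"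
    unfolding power2_norm_eq_inner
    by (simp add: inner_diff_left inner_diff_right inner_commute[of q g] power2_eq_square algebra_simps)
  also have "\<dots> = 0" using assms by (simp add: g_def dot_square_norm power2_eq_square)
  finally have g: "g = (g \<bullet> q) *\<^sub>R q" by simp
  have "frechet_derivative (hom_form c (Suc k)) (at q) w = 0" if "q \<bullet> w = 0" for w
  proof -
    have "frechet_derivative (hom_form c (Suc k)) (at q) = (\<lambda>h. g \<bullet> h)"
      unfolding g_def by (rule frechet_derivative_at[OF hom_form_has_derivative, symmetric])
    then show ?thesis by (subst (asm) g) (simp add: that)
  qed
  then show ?thesis using assms(1) by (simp add: sphere_critical_point_def)
qed

section \<open>Local data of the analytic potential and one-form\<close>

lemma has_power_series_maclaurin:
  assumes "real_analytic_on f W" "0 \<in> W"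
  shows "has_power_series f 0 (maclaurin_coeff f)"
  using someI_ex[of "has_power_series f 0"] assms by (auto simp: maclaurin_coeff_def real_analytic_on_def)

lemma sum_two_terms:
  fixes f :: "nat \<Rightarrow> 'a::comm_monoid_add"
  assumes "i < j" "j < n" "\<And>k. \<lbrakk>k < n; k \<noteq> i; k \<noteq> j\<rbrakk> \<Longrightarrow> f k = 0"
  shows "(\<Sum>k<n. f k) = f i + f j"
proof -
  have "(\<Sum>k<n. f k) = (\<Sum>k\<in>{i, j}. f k)"
    by (rule sum.mono_neutral_right) (use assms in auto)
  then show ?thesis using assms(1) by simp
qed

text \<open>A zero germ has no first jet, so \<open>first_jet_degree\<close> carries no information
  there; in that case the gradients vanish near the origin and any order k may be claimed. Otherwise
  they vanish to order d - 1.\<close>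

lemma one_form_gradients:
  fixes \<sigma> :: "('n::finite) one_form"
  assumes an: "analytic_one_form_on \<sigma> W" "0 \<in> W"
    and d: "(\<forall>\<^sub>F x in nhds 0. \<sigma> x = 0) \<or> N \<le> 2 * first_jet_degree \<sigma>"
  shows "\<exists>\<rho>>0. \<exists>s L C k. 0 \<le> C \<and> N \<le> 2 * k + 2 \<and>
    (\<forall>j. L-lipschitz_on (ball 0 \<rho>) (s j) \<and>
      (\<forall>x\<in>ball 0 \<rho>. (form_coeff \<sigma> j has_derivative (\<lambda>h. s j x \<bullet> h)) (at x) \<and>
        norm (s j x) \<le> C * norm x ^ k))"
proof -
  define c where "c j = maclaurin_coeff (form_coeff \<sigma> j)" for j
  \<comment> \<open>Differentiation lowers the order by one. For d = 0 the truncated value k = 0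
    still suffices, as N <= 0 then.\<close>
  define k where "k = first_jet_degree \<sigma> - 1"
  have ps: "has_power_series (form_coeff \<sigma> j) 0 (c j)" for j
    using an unfolding c_def analytic_one_form_on_def by (blast intro: has_power_series_maclaurin)
  have "\<exists>\<rho>>0. \<exists>g L K. (\<forall>x\<in>ball 0 \<rho>. (form_coeff \<sigma> j has_derivative (\<lambda>h. g x \<bullet> h)) (at x)) \<and>
      L-lipschitz_on (ball 0 \<rho>) g \<and> 0 \<le> K \<and> (\<forall>x\<in>ball 0 \<rho>. norm (g x) \<le> K * norm x ^ k)" for j
  proof -
    obtain \<rho> g L K where *: "0 < \<rho>" "\<forall>x\<in>ball 0 \<rho>. (form_coeff \<sigma> j has_derivative (\<lambda>h. g x \<bullet> h)) (at x)"
      "L-lipschitz_on (ball 0 \<rho>) g" "0 \<le> K"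
      "\<forall>x\<in>ball 0 \<rho>. norm (g x - (\<Sum>i<k. form_gradient (c j) i x)) \<le> K * norm x ^ k"
      using analytic_gradient[OF ps[of j]] by meson
    have "form_gradient (c j) i x = 0" if "i < k" for i x
    proof (rule form_gradient_eq_0)
      have "Suc i < first_jet_degree \<sigma>" using that by (simp add: k_def)
      from not_less_Least[OF this[unfolded first_jet_degree_def]]
      show "hom_form (c j) (Suc i) = (\<lambda>x. 0)" by (simp add: c_def hom_term_def)
    qed
    then have "(\<Sum>i<k. form_gradient (c j) i x) = 0" for x by simp
    with * show ?thesis by (intro exI[of _ \<rho>] exI[of _ g] exI[of _ L] exI[of _ K] conjI) simp_all
  qed
  then obtain \<rho> s L K where \<rho>: "\<And>j. 0 < \<rho> j"
    and s: "\<And>j x. x \<in> ball 0 (\<rho> j) \<Longrightarrow> (form_coeff \<sigma> j has_derivative (\<lambda>h. s j x \<bullet> h)) (at x)"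
      "\<And>j. (L j)-lipschitz_on (ball 0 (\<rho> j)) (s j)" "\<And>j. 0 \<le> K j"
      "\<And>j x. x \<in> ball 0 (\<rho> j) \<Longrightarrow> norm (s j x) \<le> K j * norm x ^ k"
    by metis
  define \<rho>0 where "\<rho>0 = Min (range \<rho>)"
  have \<rho>0: "0 < \<rho>0" "\<And>j. \<rho>0 \<le> \<rho> j" using \<rho> by (auto simp: \<rho>0_def)
  define L0 where "L0 = Max (range L)"
  define K0 where "K0 = Max (range K)"
  have K0: "K j \<le> K0" for j by (simp add: K0_def)
  have s': "(form_coeff \<sigma> j has_derivative (\<lambda>h. s j x \<bullet> h)) (at x)"
      "norm (s j x) \<le> K0 * norm x ^ k" if "x \<in> ball 0 \<rho>0" for j x
  proof -
    have x: "x \<in> ball 0 (\<rho> j)" using that \<rho>0(2)[of j] by simp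
    show "(form_coeff \<sigma> j has_derivative (\<lambda>h. s j x \<bullet> h)) (at x)" by (rule s(1)[OF x])
    show "norm (s j x) \<le> K0 * norm x ^ k"
      by (rule order_trans[OF s(4)[OF x] mult_right_mono[OF K0]]) simp
  qed
  have lip: "L0-lipschitz_on (ball 0 \<rho>0) (s j)" for j
  proof (rule lipschitz_on_mono[OF s(2)[of j]])
    show "ball 0 \<rho>0 \<subseteq> ball 0 (\<rho> j)" by (rule subset_ball[OF \<rho>0(2)])
  qed (simp add: L0_def)
  from d show ?thesis
  proof
    assume "N \<le> 2 * first_jet_degree \<sigma>"
    then have "N \<le> 2 * k + 2" by (simp add: k_def)
    moreover have "0 \<le> K0" using K0 s(3) order_trans by blast
    ultimately show ?thesis using \<rho>0(1) lip s' by blast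
  next
    assume "\<forall>\<^sub>F x in nhds 0. \<sigma> x = 0"
    then obtain \<rho>1 where \<rho>1: "0 < \<rho>1" "\<And>x. x \<in> ball 0 \<rho>1 \<Longrightarrow> \<sigma> x = 0"
      by (auto simp: eventually_nhds_metric dist_commute)
    define \<rho>2 where "\<rho>2 = min \<rho>0 \<rho>1"
    have \<rho>2: "0 < \<rho>2" "\<rho>2 \<le> \<rho>0" "\<rho>2 \<le> \<rho>1" using \<rho>0(1) \<rho>1(1) by (auto simp: \<rho>2_def)
    have "s j x = 0" if "x \<in> ball 0 \<rho>2" for j x
    proof -
      have x: "x \<in> ball 0 \<rho>0" "x \<in> ball 0 \<rho>1" using that \<rho>2 by auto
      have "((\<lambda>y. 0) has_derivative (\<lambda>h. s j x \<bullet> h)) (at x)"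
        by (rule has_derivative_transform_within_open[OF s'(1)[OF x(1)] open_ball x(2)])
          (simp add: form_coeff_def \<rho>1(2))
      from has_derivative_unique[OF this has_derivative_const] have "s j x \<bullet> s j x = 0" by meson
      then show ?thesis by simp
    qed
    \<comment> \<open>The witnesses are C = 0 and k = N.\<close>
    then have "norm (s j x) \<le> 0 * norm x ^ N" if "x \<in> ball 0 \<rho>2" for j x using that by simp
    moreover have "L0-lipschitz_on (ball 0 \<rho>2) (s j)" for j
      by (rule lipschitz_on_subset[OF lip subset_ball[OF \<rho>2(2)]])
    moreover have "(form_coeff \<sigma> j has_derivative (\<lambda>h. s j x \<bullet> h)) (at x)" if "x \<in> ball 0 \<rho>2" for j x
      using that \<rho>2(2) by (intro s') simp
    moreover have "N \<le> 2 * N + 2" "(0::real) \<le> 0" by auto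
    ultimately show ?thesis using \<rho>2(1) by blast
  qed
qed

text \<open>If an orbit of energy h < 0 stayed in the smaller ball, the solution would live up to
  any time, Y(x) . v would grow at least at the rate \<kappa> |h|, and yet it is bounded by M
  V.\<close>

lemma totally_unstable_lyapunov:
  fixes U :: "real ^ 'n::finite \<Rightarrow> real" and g :: "real ^ 'n \<Rightarrow> real ^ 'n"
  assumes \<rho>: "0 < \<rho>" and W: "ball 0 \<rho> \<subseteq> W" and \<kappa>: "0 < \<kappa>"
    and dU: "\<And>x. x \<in> ball 0 \<rho> \<Longrightarrow> (U has_derivative (\<lambda>h. g x \<bullet> h)) (at x)"
    and field: "\<And>x v. x \<in> ball 0 \<rho> \<Longrightarrow> - gradient U x - riesz (exterior_deriv \<sigma> x v) = - g x - R x v"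
    and Rv: "\<And>x v. R x v \<bullet> v = 0"
    and lipg: "Lg-lipschitz_on (ball 0 \<rho>) g"
    and lipR: "\<And>V. 0 \<le> V \<Longrightarrow> \<exists>LR. LR-lipschitz_on (ball 0 \<rho> \<times> cball 0 V) (\<lambda>(x, v). R x v)"
    and Ub: "\<And>x. x \<in> ball 0 \<rho> \<Longrightarrow> \<bar>U x\<bar> \<le> Um"
    and dY: "\<And>x. \<lbrakk>x \<in> ball 0 \<rho>; U x < 0\<rbrakk> \<Longrightarrow> (Y has_derivative Y' x) (at x)"
    and nY: "\<And>x. \<lbrakk>x \<in> ball 0 \<rho>; U x < 0\<rbrakk> \<Longrightarrow> norm (Y x) \<le> M"
    and lyap: "\<And>x v. \<lbrakk>x \<in> ball 0 \<rho>; U x < 0\<rbrakk> \<Longrightarrow> - \<kappa> * U x \<le> Y' x v \<bullet> v + Y x \<bullet> (- g x - R x v)"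
  shows "totally_unstable W U \<sigma> 0"
  unfolding totally_unstable_def
proof (intro exI[of _ "ball 0 (\<rho> / 2)"] conjI ballI impI notI)
  show "open (ball (0 :: real ^ 'n) (\<rho> / 2))" "0 \<in> ball (0 :: real ^ 'n) (\<rho> / 2)" using \<rho> by auto
  show "ball 0 (\<rho> / 2) \<subseteq> W" using W \<rho> by (auto simp: subset_iff)
  fix z0 :: "(real ^ 'n) \<times> (real ^ 'n)"
  assume z0: "z0 \<in> ball 0 (\<rho> / 2) \<times> UNIV" and neg: "energy U z0 < 0"
    and orbit: "positive_orbit W U \<sigma> z0 \<subseteq> ball 0 (\<rho> / 2) \<times> UNIV"
  define h where "h = energy U z0"
  \<comment> \<open>Energy h < 0 gives |v|^2 < 2 Um <= V^2; this V avoids a square root and is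
    positive even for Um = 0.\<close>
  define V where "V = 2 * Um + 2"
  \<comment> \<open>The radius lies strictly between \<rho>/2, where the orbit is assumed to stay,
    and \<rho>, where the field is controlled; so the orbit runs in the interior of K.\<close>
  define K where "K = cball (0 :: real ^ 'n) (3/4 * \<rho>) \<times> cball (0 :: real ^ 'n) V"
  define F where "F = (\<lambda>(x, v). (v, - g x - R x v))"
  have Um: "0 \<le> Um" using Ub[of 0] \<rho> by (smt (verit) centre_in_ball)
  have KB: "x \<in> ball 0 \<rho>" if "(x, v) \<in> K" for x v using that \<rho> by (auto simp: K_def)
  have speed: "norm v < V" if "energy U (x, v) = h" "x \<in> ball 0 \<rho>" for x v
  proof -
    have "(norm v)\<^sup>2 / 2 + U x < 0" using that(1) neg by (simp add: energy_def h_def)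
    then have "(norm v)\<^sup>2 < 2 * Um" using Ub[OF that(2)] by linarith
    also have "\<dots> \<le> V\<^sup>2" using Um zero_le_power2[of Um] by (simp add: V_def power2_eq_square algebra_simps)
    finally show ?thesis by (rule power_less_imp_less_base) (use Um in \<open>simp add: V_def\<close>)
  qed
  have int: "interior K = ball 0 (3/4 * \<rho>) \<times> ball 0 V" by (simp add: K_def interior_Times)
  have intI: "(x, v) \<in> interior K" if "energy U (x, v) = h" "x \<in> ball 0 (\<rho> / 2)" for x v
    using speed[OF that(1)] that(2) \<rho> by (auto simp: int)
  obtain LR where LR: "LR-lipschitz_on (ball 0 \<rho> \<times> cball 0 V) (\<lambda>(x, v). R x v)"
    using lipR[of V] Um by (auto simp: V_def)
  have lipF: "(1 + (Lg + LR))-lipschitz_on K F"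
  proof (rule lipschitz_onI)
    fix z w assume z: "z \<in> K" and w: "w \<in> K"
    have K': "y \<in> ball 0 \<rho> \<times> cball 0 V" if "y \<in> K" for y using that \<rho> by (auto simp: K_def)
    have "dist (F z) (F w) \<le> dist (snd z) (snd w) +
        dist (- g (fst z) - R (fst z) (snd z)) (- g (fst w) - R (fst w) (snd w))"
      unfolding F_def case_prod_beta dist_Pair_Pair by (rule order_trans[OF sqrt_sum_squares_le_sum]) auto
    also have "dist (- g (fst z) - R (fst z) (snd z)) (- g (fst w) - R (fst w) (snd w)) \<le>
        dist (g (fst z)) (g (fst w)) + dist (R (fst z) (snd z)) (R (fst w) (snd w))"
      unfolding dist_norm using norm_triangle_ineq4[of "g (fst w) - g (fst z)" "R (fst z) (snd z) - R (fst w) (snd w)"]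
      by (simp add: algebra_simps norm_minus_commute)
    also have "dist (g (fst z)) (g (fst w)) \<le> Lg * dist (fst z) (fst w)"
      by (rule lipschitz_onD[OF lipg]) (use K'[OF z] K'[OF w] in auto)
    also have "dist (R (fst z) (snd z)) (R (fst w) (snd w)) \<le> LR * dist z w"
      using lipschitz_onD[OF LR K'[OF z] K'[OF w]] by (simp add: case_prod_beta)
    also have "Lg * dist (fst z) (fst w) \<le> Lg * dist z w"
      by (intro mult_left_mono dist_fst_le lipschitz_on_nonneg[OF lipg])
    also have "dist (snd z) (snd w) \<le> dist z w" by (rule dist_snd_le)
    finally show "dist (F z) (F w) \<le> (1 + (Lg + LR)) * dist z w" by (simp add: algebra_simps)
  qed (use lipschitz_on_nonneg[OF lipg] lipschitz_on_nonneg[OF LR] in simp)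
  \<comment> \<open>This feeds the confinement condition: the endpoint of any solution in K lies on
    the positive orbit, which bounds its position, and has energy h, which bounds its speed.\<close>
  have solution: "energy U (z t) = h \<and> z t \<in> positive_orbit W U \<sigma> z0"
    if t: "0 \<le> t" and z: "z 0 = z0" "\<And>s. s \<in> {0..t} \<Longrightarrow> z s \<in> K"
      "\<And>s. s \<in> {0..t} \<Longrightarrow> (z has_vector_derivative F (z s)) (at s within {0..t})" for t z
  proof -
    define x where "x s = fst (z s)" for s
    define v where "v s = snd (z s)" for s
    have xB: "x s \<in> ball 0 \<rho>" if "s \<in> {0..t}" for s
      using KB[of "x s" "v s"] z(2)[OF that] by (simp add: x_def v_def)
    have dz: "(z has_derivative (\<lambda>r. r *\<^sub>R F (z s))) (at s within {0..t})" if "s \<in> {0..t}" for s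
      using z(3)[OF that] by (simp add: has_vector_derivative_def)
    have dx: "(x has_derivative (\<lambda>r. r *\<^sub>R v s)) (at s within {0..t})" if "s \<in> {0..t}" for s
      using has_derivative_fst[OF dz[OF that]] by (simp add: x_def[abs_def] v_def F_def case_prod_beta)
    have dv: "(v has_derivative (\<lambda>r. r *\<^sub>R (- g (x s) - R (x s) (v s)))) (at s within {0..t})" if "s \<in> {0..t}" for s
      using has_derivative_snd[OF dz[OF that]] by (simp add: v_def[abs_def] x_def F_def case_prod_beta)
    have "EL_solution W U \<sigma> {0..t} x v"
      unfolding EL_solution_def has_vector_derivative_def
      using dx dv xB W field by (auto simp: subset_iff simp del: mem_ball mem_ball_0)
    then have "z t \<in> positive_orbit W U \<sigma> z0"
      using t z(1) unfolding positive_orbit_def by (intro CollectI exI[of _ x] exI[of _ v] exI[of _ t]) (simp add: x_def v_def)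
    moreover have "energy U (z t) = h"
    proof (cases "t = 0")
      case True then show ?thesis by (simp add: z(1) h_def)
    next
      case False
      have dE: "((\<lambda>s. energy U (z s)) has_derivative (\<lambda>r. 0)) (at s within {0..t})" if s: "s \<in> {0..t}" for s
      proof -
        have "((\<lambda>s. 1/2 * (v s \<bullet> v s) + U (x s)) has_derivative
            (\<lambda>r. 1/2 * (v s \<bullet> (r *\<^sub>R (- g (x s) - R (x s) (v s))) + (r *\<^sub>R (- g (x s) - R (x s) (v s))) \<bullet> v s)
              + g (x s) \<bullet> (r *\<^sub>R v s))) (at s within {0..t})"
          by (intro has_derivative_add has_derivative_mult_right has_derivative_inner dv s
              has_derivative_compose[OF dx[OF s] dU[OF xB[OF s]]])
        then have "((\<lambda>s. 1/2 * (v s \<bullet> v s) + U (x s)) has_derivative (\<lambda>r. 0)) (at s within {0..t})"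
          by (rule has_derivative_eq_rhs)
            (simp add: fun_eq_iff inner_diff_right inner_diff_left Rv inner_commute[of "v s"])
        then show ?thesis by (simp add: energy_def x_def v_def dot_square_norm)
      qed
      have "\<exists>s\<in>{0<..<t}. energy U (z t) - energy U (z 0) = (\<lambda>r. 0) (t - 0)"
        using False t by (intro mvt_simple[where f' = "\<lambda>_ r. 0"] dE) auto
      then show ?thesis by (simp add: z(1) h_def)
    qed
    ultimately show ?thesis by blast
  qed
  define e where "e = \<kappa> * - h"
  \<comment> \<open>Growth at rate e during this time adds at least 2 M V + 1, more than the
    oscillation 2 M V allowed by |G| <= M V.\<close>
  define T where "T = (2 * M * V + 1) / e"
  have h0: "h < 0" using neg by (simp add: h_def)
  have e: "0 < e" using \<kappa> h0 by (simp add: e_def mult_pos_neg)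
  have U0: "U (fst z0) < 0" using neg zero_le_power2[of "norm (snd z0)"] unfolding energy_def by linarith
  have "norm (Y (fst z0)) \<le> M"
    using z0 \<rho> U0 by (intro nY) auto
  then have M: "0 \<le> M" using norm_ge_zero order_trans by blast
  have T: "0 < T" unfolding T_def using e M Um by (intro divide_pos_pos) (auto simp: V_def add_nonneg_pos)
  have "z0 \<in> interior K" using intI[of "fst z0" "snd z0"] z0 by (auto simp: h_def)
  then have "\<exists>z. z 0 = z0 \<and> (\<forall>t\<in>{0..T}. z t \<in> K \<and> (z has_vector_derivative F (z t)) (at t within {0..T}))"
  proof (rule ode_solution_in_compact[rotated 3])
    show "convex K" "closed K" by (auto simp: K_def convex_Times closed_Times)
    show "(1 + (Lg + LR))-lipschitz_on K F" by (rule lipF)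
    fix t z assume "0 \<le> t" "z 0 = z0" "\<And>s. s \<in> {0..t} \<Longrightarrow> z s \<in> K"
      "\<And>s. s \<in> {0..t} \<Longrightarrow> (z has_vector_derivative F (z s)) (at s within {0..t})"
    from solution[OF this] show "z t \<in> interior K"
      using orbit intI[of "fst (z t)" "snd (z t)"] by auto
  qed (use T in simp)
  then obtain z where z: "z 0 = z0" and zK: "\<And>t. t \<in> {0..T} \<Longrightarrow> z t \<in> K"
    and dz: "\<And>t. t \<in> {0..T} \<Longrightarrow> (z has_vector_derivative F (z t)) (at t within {0..T})"
    by blast
  have Eh: "energy U (z t) = h" if "t \<in> {0..T}" for t
  proof -
    have "energy U (z t) = h \<and> z t \<in> positive_orbit W U \<sigma> z0"
    proof (rule solution)
      show "(z has_vector_derivative F (z s)) (at s within {0..t})" if "s \<in> {0..t}" for s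
        by (rule has_vector_derivative_within_subset[OF dz]) (use that \<open>t \<in> {0..T}\<close> in auto)
    qed (use that z zK in auto)
    then show ?thesis ..
  qed
  define G where "G t = Y (fst (z t)) \<bullet> snd (z t)" for t
  define G' where "G' t = Y' (fst (z t)) (snd (z t)) \<bullet> snd (z t) +
    Y (fst (z t)) \<bullet> (- g (fst (z t)) - R (fst (z t)) (snd (z t)))" for t
  have xB: "fst (z t) \<in> ball 0 \<rho>" if "t \<in> {0..T}" for t
    using KB[of "fst (z t)" "snd (z t)"] zK[OF that] by simp
  have Uh: "U (fst (z t)) \<le> h" if "t \<in> {0..T}" for t
    using Eh[OF that] zero_le_power2[of "norm (snd (z t))"] unfolding energy_def by linarith
  have Gb: "\<bar>G t\<bar> \<le> M * V" if "t \<in> {0..T}" for t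
  proof -
    have "\<bar>G t\<bar> \<le> norm (Y (fst (z t))) * norm (snd (z t))" unfolding G_def by (rule Cauchy_Schwarz_ineq2)
    also have "\<dots> \<le> M * V"
      using nY[OF xB[OF that]] Uh[OF that] h0 speed[of "fst (z t)" "snd (z t)"] Eh[OF that] xB[OF that] M
      by (intro mult_mono) (auto simp del: mem_ball mem_ball_0)
    finally show ?thesis .
  qed
  have "(G has_derivative (\<lambda>r. r * G' t)) (at t within {0..T})" if t: "t \<in> {0..T}" for t
  proof -
    have dzt: "(z has_derivative (\<lambda>r. r *\<^sub>R F (z t))) (at t within {0..T})"
      using dz[OF t] by (simp add: has_vector_derivative_def)
    have dx: "((\<lambda>s. fst (z s)) has_derivative (\<lambda>r. r *\<^sub>R snd (z t))) (at t within {0..T})"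
      using has_derivative_fst[OF dzt] by (simp add: F_def case_prod_beta)
    have dv: "((\<lambda>s. snd (z s)) has_derivative (\<lambda>r. r *\<^sub>R (- g (fst (z t)) - R (fst (z t)) (snd (z t)))))
        (at t within {0..T})"
      using has_derivative_snd[OF dzt] by (simp add: F_def case_prod_beta)
    have dYt: "(Y has_derivative Y' (fst (z t))) (at (fst (z t)))"
      by (rule dY[OF xB[OF t]]) (use Uh[OF t] h0 in simp)
    have "linear (Y' (fst (z t)))" using dYt by (rule has_derivative_linear)
    then have lin: "Y' (fst (z t)) (r *\<^sub>R y) = r *\<^sub>R Y' (fst (z t)) y" for r y by (rule linear_cmul)
    have "(G has_derivative (\<lambda>r. Y (fst (z t)) \<bullet> (r *\<^sub>R (- g (fst (z t)) - R (fst (z t)) (snd (z t)))) +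
        Y' (fst (z t)) (r *\<^sub>R snd (z t)) \<bullet> snd (z t))) (at t within {0..T})"
      unfolding G_def[abs_def] by (intro has_derivative_inner dv has_derivative_compose[OF dx dYt])
    then show ?thesis
      by (rule has_derivative_eq_rhs) (simp add: G'_def lin fun_eq_iff algebra_simps)
  qed
  then obtain s where s: "s \<in> {0<..<T}" "G T - G 0 = (T - 0) * G' s"
    using mvt_simple[OF T, of G "\<lambda>t r. r * G' t"] by auto
  have "e \<le> - \<kappa> * U (fst (z s))" using Uh[of s] s(1) \<kappa> by (simp add: e_def)
  also have "\<dots> \<le> G' s" unfolding G'_def using s(1) Uh[of s] h0 by (intro lyap xB) auto
  finally have "T * e \<le> T * G' s" using T by (intro mult_left_mono) auto
  moreover have "T * e = 2 * M * V + 1" using e by (simp add: T_def)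
  ultimately show False using s(2) Gb[of T] Gb[of 0] T by auto
qed

theorem corollary1p4:
  fixes W :: "(real ^ 'n::finite) set"
    and U :: "real ^ 'n \<Rightarrow> real"
    and \<sigma> :: "'n one_form"
    and l1 l2 :: nat
  assumes "open W" and "0 \<in> W"
    and "real_analytic_on U W"
    and "analytic_one_form_on \<sigma> W"
    and "U 0 = 0"
    and "(U has_derivative (\<lambda>h. 0)) (at 0)"
    and "\<not> (\<exists>k P. homogeneous_polynomial k P \<and> (\<forall>x\<in>W. U x = P x))"
    and "first_two_degrees U l1 l2"
    and "(\<forall>\<^sub>F x in nhds 0. \<sigma> x = 0) \<or>
         real (first_jet_degree \<sigma>) - real l1 / 2 > real l2 - real l1"
    and "\<And>q. sphere_critical_point (hom_term U l1) q \<Longrightarrow> hom_term U l1 q \<le> 0 \<Longrightarrow>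
           hom_term U l2 q < 0"
  shows "totally_unstable W U \<sigma> 0"
proof -
  define c where "c = maclaurin_coeff U"
  have hom: "hom_term U k = hom_form c k" for k by (simp add: hom_term_def c_def)
  obtain \<rho>U g Lg where \<rho>U: "0 < \<rho>U"
    and dU: "\<And>x. x \<in> ball 0 \<rho>U \<Longrightarrow> (U has_derivative (\<lambda>h. g x \<bullet> h)) (at x)"
    and lipg: "Lg-lipschitz_on (ball 0 \<rho>U) g"
    and remU: "\<And>m. \<exists>C\<ge>0. \<forall>x\<in>ball 0 \<rho>U. \<bar>U x - (\<Sum>k<m. hom_form c k x)\<bar> \<le> C * norm x ^ m"
    and remg: "\<And>m. \<exists>C\<ge>0. \<forall>x\<in>ball 0 \<rho>U. norm (g x - (\<Sum>k<m. form_gradient c k x)) \<le> C * norm x ^ m"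
    using analytic_gradient[OF has_power_series_maclaurin[OF assms(3,2)]] unfolding c_def by blast
  have nz: "l1 < l2" "hom_form c l1 \<noteq> (\<lambda>x. 0)" "\<And>k. \<lbrakk>k < l2; k \<noteq> l1\<rbrakk> \<Longrightarrow> hom_form c k = (\<lambda>x. 0)"
    using assms(8) by (auto simp: first_two_degrees_def hom)
  have "l1 \<noteq> 0"
  proof
    assume "l1 = 0"
    obtain C where "\<forall>x\<in>ball 0 \<rho>U. \<bar>U x - (\<Sum>k<1. hom_form c k x)\<bar> \<le> C * norm x ^ 1"
      using remU by blast
    then have "\<bar>U 0 - (\<Sum>k<1. hom_form c k 0)\<bar> \<le> C * norm (0 :: real ^ 'n) ^ 1" using \<rho>U by (meson centre_in_ball)
    then have "hom_form c 0 = (\<lambda>x. 0)" using assms(5) by (simp add: hom_form_0 fun_eq_iff)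
    then show False using nz(2) \<open>l1 = 0\<close> by simp
  qed
  \<comment> \<open>The linear form has the constant gradient \<open>g 0\<close>, which is zero by
    assumption; Euler's identity then makes the form vanish.\<close>
  moreover have "l1 \<noteq> 1"
  proof
    assume "l1 = 1"
    obtain C where "\<forall>x\<in>ball 0 \<rho>U. norm (g x - (\<Sum>k<1. form_gradient c k x)) \<le> C * norm x ^ 1"
      using remg by blast
    then have "norm (g 0 - (\<Sum>k<1. form_gradient c k 0)) \<le> C * norm (0 :: real ^ 'n) ^ 1" using \<rho>U by (meson centre_in_ball)
    then have g0: "g 0 = form_gradient c 0 0" by simp
    have gz: "g 0 \<bullet> h = 0" for h
      using has_derivative_unique[OF dU[of 0] assms(6)] \<rho>U by (simp add: fun_eq_iff)
    have "form_gradient c 0 x = g 0" for x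
      unfolding g0 by (simp add: form_gradient_def hom_form_0)
    then have "hom_form c 1 x = 0" for x
      using form_gradient_inner_self[of c 0 x] gz[of x] by simp
    then show False using nz(2) \<open>l1 = 1\<close> by auto
  qed
  ultimately have "\<exists>a. l1 = a + 2" by (intro exI[of _ "l1 - 2"]) auto
  then obtain a where l1: "l1 = a + 2" by blast
  have "\<exists>m. l2 = a + m + 3" using nz(1) l1 by (intro exI[of _ "l2 - a - 3"]) auto
  then obtain m where l2: "l2 = a + m + 3" by blast
  have sumU: "(\<Sum>k<a + m + 4. hom_form c k x) = hom_form c (a + 2) x + hom_form c (a + m + 3) x" for x
    by (rule sum_two_terms) (use nz(3) in \<open>auto simp: l1 l2\<close>)
  \<comment> \<open>Gradient indices are one below the degrees, so this sum ends with the gradient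
    of the form of degree l2, as does the sum for U with one more term.\<close>
  have sumg: "(\<Sum>k<a + m + 3. form_gradient c k x) = form_gradient c (Suc a) x + form_gradient c (a + m + 2) x" for x
    by (rule sum_two_terms) (use nz(3) in \<open>auto simp: l1 l2 intro!: form_gradient_eq_0\<close>)
  obtain CE where CE: "0 \<le> CE" "\<And>x. x \<in> ball 0 \<rho>U \<Longrightarrow>
      \<bar>U x - (hom_form c (a + 2) x + hom_form c (a + m + 3) x)\<bar> \<le> CE * norm x ^ (a + m + 4)"
    using remU[of "a + m + 4"] unfolding sumU by blast
  obtain Ce where Ce: "0 \<le> Ce" "\<And>x. x \<in> ball 0 \<rho>U \<Longrightarrow>
      norm (g x - (form_gradient c (Suc a) x + form_gradient c (a + m + 2) x)) \<le> Ce * norm x ^ (a + m + 3)"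
    using remg[of "a + m + 3"] unfolding sumg by blast
  obtain CU where CU: "\<And>x. x \<in> ball 0 \<rho>U \<Longrightarrow> \<bar>U x\<bar> \<le> CU"
    using remU[of 0] by (simp del: mem_ball mem_ball_0) blast
  \<comment> \<open>The assumption on d reads 2 d > 2 l2 - l1 = l2 + (l2 - l1), and l2 - l1 >= 1, so
    2 d is at least l2 + 1 = a + m + 4.\<close>
  have "(\<forall>\<^sub>F x in nhds 0. \<sigma> x = 0) \<or> a + m + 4 \<le> 2 * first_jet_degree \<sigma>"
    using assms(9) unfolding l1 l2 by (auto simp: field_simps)
  then obtain \<rho>\<sigma> s L C k where \<rho>\<sigma>: "0 < \<rho>\<sigma>" and C: "0 \<le> C" and k: "a + m + 4 \<le> 2 * k + 2"
    and s: "\<And>j. L-lipschitz_on (ball 0 \<rho>\<sigma>) (s j)"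
      "\<And>j x. x \<in> ball 0 \<rho>\<sigma> \<Longrightarrow> (form_coeff \<sigma> j has_derivative (\<lambda>h. s j x \<bullet> h)) (at x)"
      "\<And>j x. x \<in> ball 0 \<rho>\<sigma> \<Longrightarrow> norm (s j x) \<le> C * norm x ^ k"
    using one_form_gradients[OF assms(4,2), of "a + m + 4"] by blast
  obtain \<rho>W where \<rho>W: "0 < \<rho>W" "ball 0 \<rho>W \<subseteq> W"
    using assms(1,2) open_contains_ball by blast
  define R where "R x v = magnetic (\<lambda>j. s j x) v" for x v
  define \<rho> where "\<rho> = min \<rho>U (min \<rho>\<sigma> \<rho>W)"
  have \<rho>: "0 < \<rho>" "\<rho> \<le> \<rho>U" "\<rho> \<le> \<rho>\<sigma>" "\<rho> \<le> \<rho>W" using \<rho>U \<rho>\<sigma> \<rho>W by (auto simp: \<rho>_def)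
  define CR where "CR = 2 * real CARD('n) * C"
  have nR: "norm (R x v) \<le> CR * norm x ^ k * norm v" if "x \<in> ball 0 \<rho>\<sigma>" for x v
  proof -
    have "norm (R x v) \<le> 2 * (\<Sum>j\<in>UNIV. norm (s j x)) * norm v" unfolding R_def by (rule norm_magnetic_le)
    also have "\<dots> \<le> 2 * (\<Sum>j\<in>(UNIV :: 'n set). C * norm x ^ k) * norm v"
      by (intro mult_right_mono mult_left_mono sum_mono s(3) that) auto
    finally show ?thesis by (simp add: CR_def mult_ac)
  qed
  have "\<exists>\<rho>'>0. \<exists>Y Y' M. \<rho>' \<le> \<rho> \<and> (\<forall>x\<in>ball 0 \<rho>'. U x < 0 \<longrightarrow>
    (Y has_derivative Y' x) (at x) \<and> norm (Y x) \<le> M \<and>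
    (\<forall>v. - real (a + 2) * U x \<le> Y' x v \<bullet> v + Y x \<bullet> (- g x - R x v)))"
  proof (rule lyapunov_field[where c = c and m = m and k = k and CE = CE and Ce = Ce and CR = CR])
    fix q :: "real ^ 'n" assume "norm q = 1" "hom_form c (a + 2) q \<le> 0"
      "(norm (form_gradient c (Suc a) q))\<^sup>2 - (form_gradient c (Suc a) q \<bullet> q)\<^sup>2 = 0"
    then show "hom_form c (a + m + 3) q < 0"
      using assms(10)[of q] sphere_critical_pointI[of q c "Suc a"] by (simp add: hom l1 l2)
  next
    show "0 \<le> CR" using C by (simp add: CR_def)
  qed (use \<rho> CE Ce nR k assms(5) in auto)
  then obtain \<rho>' Y Y' M where \<rho>': "0 < \<rho>'" "\<rho>' \<le> \<rho>"
    and Y: "\<And>x. \<lbrakk>x \<in> ball 0 \<rho>'; U x < 0\<rbrakk> \<Longrightarrow> (Y has_derivative Y' x) (at x)"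
      "\<And>x. \<lbrakk>x \<in> ball 0 \<rho>'; U x < 0\<rbrakk> \<Longrightarrow> norm (Y x) \<le> M"
      "\<And>x v. \<lbrakk>x \<in> ball 0 \<rho>'; U x < 0\<rbrakk> \<Longrightarrow> - real (a + 2) * U x \<le> Y' x v \<bullet> v + Y x \<bullet> (- g x - R x v)"
    by blast
  have sub: "ball (0 :: real ^ 'n) \<rho>' \<subseteq> ball 0 \<rho>U" "ball (0 :: real ^ 'n) \<rho>' \<subseteq> ball 0 \<rho>\<sigma>" "ball (0 :: real ^ 'n) \<rho>' \<subseteq> ball 0 \<rho>W"
    using \<rho> \<rho>' by (auto intro!: subset_ball)
  show ?thesis
  proof (rule totally_unstable_lyapunov[OF \<rho>'(1) _ _ dU _ _ lipschitz_on_subset[OF lipg sub(1)] _ CU Y])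
    show "ball 0 \<rho>' \<subseteq> W" using sub(3) \<rho>W(2) by blast
    show "0 < real (a + 2)" by simp
    show "R x v \<bullet> v = 0" for x v unfolding R_def by (rule magnetic_inner_self)
    show "- gradient U x - riesz (exterior_deriv \<sigma> x v) = - g x - R x v" if "x \<in> ball 0 \<rho>'" for x v
    proof -
      have "gradient U x = g x" using that sub(1) by (intro gradient_eqI dU) blast
      moreover have "riesz (exterior_deriv \<sigma> x v) = R x v" unfolding R_def
        using that sub(2) by (intro riesz_eqI exterior_deriv_eq_magnetic s(2)) blast
      ultimately show ?thesis by simp
    qed
    show "\<exists>LR. LR-lipschitz_on (ball 0 \<rho>' \<times> cball 0 V) (\<lambda>(x, v). R x v)" if "0 \<le> V" for V
      unfolding R_def
    proof (rule exI, rule lipschitz_on_magnetic[OF _ _ _ that])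
      show "L-lipschitz_on (ball 0 \<rho>') (s j)" for j by (rule lipschitz_on_subset[OF s(1) sub(2)])
      show "0 \<le> C * \<rho>\<sigma> ^ k" using C \<rho>\<sigma> by simp
      fix x :: "real ^ 'n" and j assume "x \<in> ball 0 \<rho>'"
      then have x: "x \<in> ball 0 \<rho>\<sigma>" using sub(2) by blast
      have "C * norm x ^ k \<le> C * \<rho>\<sigma> ^ k" using x C by (intro mult_left_mono power_mono) auto
      with s(3)[OF x, of j] show "norm (s j x) \<le> C * \<rho>\<sigma> ^ k" by linarith
    qed
  qed (use sub in auto)
qed

end
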